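(* $r(K_5-e,K_5-K_{1,3})=19$.
   Context: Graphs are finite and simple. For graphs $G$ and $H$, $r(G,H)$ is the smallest integer $N$ such that for every $n\ge N$ and every coloring of the edges of the complete graph $K_n$ with red and blue there is either a red copy of $G$ or a blue copy of $H$ (copies are subgraphs, not necessarily induced). $K_n-e$ is the complete graph on $n$ vertices with one edge deleted. For $s\le n-1$, $K_n-K_{1,s}$ is the graph obtained from $K_n$ by deleting the edges of a star $K_{1,s}$, i.e. deleting $s$ edges all incident to one common vertex. *)

theory Defs
  imports "HOL-Library.Ramsey"
begin

text \<open>A graph is a pair of a vertex set and a set of two-element edges.\<close>

type_synonym 'a graph = "'a set \<times> 'a set set"

abbreviation verts :: "'a graph \<Rightarrow> 'a set" where
  "verts G \<equiv> fst G"

abbreviation edges :: "'a graph \<Rightarrow> 'a set set" where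
  "edges G \<equiv> snd G"

definition simple_graph :: "'a graph \<Rightarrow> bool" where
  "simple_graph G \<longleftrightarrow> finite (verts G) \<and> edges G \<subseteq> [verts G]\<^bsup>2\<^esup>"

text \<open>\<open>H\<close> contains a (not necessarily induced) subgraph isomorphic to \<open>G\<close>.\<close>

definition contains_copy :: "'b graph \<Rightarrow> 'a graph \<Rightarrow> bool" where
  "contains_copy H G \<longleftrightarrow>
     (\<exists>f. inj_on f (verts G) \<and> f ` verts G \<subseteq> verts H \<and> (\<forall>e\<in>edges G. f ` e \<in> edges H))"

definition complete_graph :: "nat \<Rightarrow> nat graph" where
  "complete_graph n = ({..<n}, [{..<n}]\<^bsup>2\<^esup>)"

datatype colour = Red | Blue

text \<open>
  An edge colouring is a total function on sets of vertices; only its values on the edges of the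
  coloured graph matter.
\<close>

definition colour_class :: "'a graph \<Rightarrow> ('a set \<Rightarrow> colour) \<Rightarrow> colour \<Rightarrow> 'a graph" where
  "colour_class G c k = (verts G, {e \<in> edges G. c e = k})"

definition ramsey_number :: "'a graph \<Rightarrow> 'b graph \<Rightarrow> nat" where
  "ramsey_number G H =
     (LEAST N. \<forall>n\<ge>N. \<forall>c.
        contains_copy (colour_class (complete_graph n) c Red) G \<or>
        contains_copy (colour_class (complete_graph n) c Blue) H)"

definition delete_edges :: "'a graph \<Rightarrow> 'a set set \<Rightarrow> 'a graph" where
  "delete_edges G F = (verts G, edges G - F)"

text \<open>
  The deleted edge and the deleted star are fixed representatives: all choices give isomorphic
  graphs. The intended ranges are \<open>n \<ge> 2\<close> and \<open>s \<le> n - 1\<close> respectively.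
\<close>

definition complete_minus_edge :: "nat \<Rightarrow> nat graph" where
  "complete_minus_edge n = delete_edges (complete_graph n) {{0, 1}}"

definition complete_minus_star :: "nat \<Rightarrow> nat \<Rightarrow> nat graph" where
  "complete_minus_star n s = delete_edges (complete_graph n) {{0, i} | i. i \<in> {1..s}}"

lemma simple_graph_complete_graph: "simple_graph (complete_graph n)"
  by (simp add: simple_graph_def complete_graph_def)

lemma simple_graph_delete_edges: "simple_graph G \<Longrightarrow> simple_graph (delete_edges G F)"
  by (auto simp: simple_graph_def delete_edges_def)

lemma simple_graph_complete_minus_edge: "simple_graph (complete_minus_edge n)"
  by (simp add: complete_minus_edge_def simple_graph_complete_graph simple_graph_delete_edges)

lemma simple_graph_complete_minus_star: "simple_graph (complete_minus_star n s)"
  by (simp add: complete_minus_star_def simple_graph_complete_graph simple_graph_delete_edges)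

lemma card_edges_complete_graph: "card (edges (complete_graph n)) = n choose 2"
  by (simp add: complete_graph_def card_nsets)

lemma card_edges_complete_minus_edge:
  assumes "n \<ge> 2"
  shows "card (edges (complete_minus_edge n)) = (n choose 2) - 1"
proof -
  have "{0, 1} \<in> [{..<n}]\<^bsup>2\<^esup>"
    using assms by (auto simp: nsets_def)
  then show ?thesis
    by (simp add: complete_minus_edge_def delete_edges_def complete_graph_def card_nsets
        card_Diff_singleton)
qed

lemma card_edges_complete_minus_star:
  assumes "s < n"
  shows "card (edges (complete_minus_star n s)) = (n choose 2) - s"
proof -
  let ?S = "{{0, i} | i. i \<in> {1..s}}"
  have S: "?S = (\<lambda>i. {0, i}) ` {1..s}"
    by auto
  have "inj_on (\<lambda>i. {0, i}) {1..s}"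
    by (auto simp: inj_on_def doubleton_eq_iff)
  then have card: "card ?S = s"
    unfolding S by (simp add: card_image)
  have "?S \<subseteq> [{..<n}]\<^bsup>2\<^esup>"
    using assms by (auto simp: nsets_def)
  moreover have "finite ?S"
    unfolding S by simp
  ultimately have "card ([{..<n}]\<^bsup>2\<^esup> - ?S) = (n choose 2) - s"
    by (simp only: card_Diff_subset card card_nsets finite_lessThan card_lessThan)
  then show ?thesis
    by (simp add: complete_minus_star_def delete_edges_def complete_graph_def)
qed

end

theory Submission
  imports Defs "HOL-Library.List_Lexorder"
begin

text \<open>
  A colouring has neither a blue \<open>K\<^sub>4\<close> nor a red \<open>K\<^sub>5 - e\<close> iff its blue graph is \<open>K\<^sub>4\<close>-free and
  any five vertices span at least two blue edges. Suppose this holds on 19 vertices. In the blue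
  neighbourhood of a vertex there is no blue triangle and any five vertices span two blue edges; this is
  impossible on 11 vertices, and on 10 vertices it leaves only the Petersen graph and the blow-up of
  \<open>C\<^sub>5\<close>. In the red neighbourhood there is no blue \<open>K\<^sub>4\<close> and any four vertices span two blue edges;
  this is impossible on 11 vertices, and on 10 vertices it leaves five graphs. None of these seven graphs
  can be completed to a colouring of the 19 vertices, so every vertex has blue degree 9, contradicting
  the parity of \<open>19 \<cdot> 9\<close>. Hence 19 vertices without a red \<open>K\<^sub>5 - e\<close> contain a blue \<open>K\<^sub>4\<close>. If no blue
  edge leaves it, all other vertices are joined to it in red, so they contain no red triangle, and this
  yields a blue \<open>K\<^sub>4\<close> with a pendant edge among them.

  The finite case analyses are propositional and are refuted by the proof method \<open>sat\<close>; they become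
  small enough once the vertices are labelled in a lexicographically sorted way.
\<close>

section \<open>Propositional encoding of forbidden subgraphs\<close>

primrec some_true :: "bool list \<Rightarrow> bool" where
  "some_true [] = False"
| "some_true (b # bs) = (b \<or> some_true bs)"

primrec two_true :: "bool list \<Rightarrow> bool" where
  "two_true [] = False"
| "two_true (b # bs) = (b \<and> some_true bs \<or> two_true bs)"

primrec edge_list :: "('a \<Rightarrow> 'a \<Rightarrow> bool) \<Rightarrow> 'a list \<Rightarrow> bool list" where
  "edge_list B [] = []"
| "edge_list B (x # xs) = map (B x) xs @ edge_list B xs"

text \<open>\<open>B\<close> is blue adjacency. The second condition forbids a red
  \<open>K_l - e\<close>: \<open>l\<close> vertices with at most one blue edge contain one. Both
  sizes are parameters because passing to a blue neighbourhood lowers \<open>k\<close> and passing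
  to a red one lowers \<open>l\<close>.\<close>

definition avoids :: "('a \<Rightarrow> 'a \<Rightarrow> bool) \<Rightarrow> nat \<Rightarrow> nat \<Rightarrow> 'a set \<Rightarrow> bool" where
  "avoids B k l V \<longleftrightarrow> (\<forall>xs. distinct xs \<and> set xs \<subseteq> V \<longrightarrow>
     (length xs = k \<longrightarrow> some_true (map Not (edge_list B xs))) \<and>
     (length xs = l \<longrightarrow> two_true (edge_list B xs)))"

fun choose_list :: "nat \<Rightarrow> 'a list \<Rightarrow> 'a list list" where
  "choose_list 0 xs = [[]]"
| "choose_list (Suc k) [] = []"
| "choose_list (Suc k) (x # xs) = map ((#) x) (choose_list k xs) @ choose_list (Suc k) xs"

lemma choose_listD:
  "ys \<in> set (choose_list k xs) \<Longrightarrow> length ys = k \<and> set ys \<subseteq> set xs \<and> (distinct xs \<longrightarrow> distinct ys)"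
proof (induction k xs arbitrary: ys rule: choose_list.induct)
  case (3 k x xs)
  from "3.prems" consider zs where "ys = x # zs" "zs \<in> set (choose_list k xs)"
    | "ys \<in> set (choose_list (Suc k) xs)"
    by auto
  then show ?case
    using "3.IH" by cases (metis distinct.simps(2) insert_mono length_Cons list.simps(15) subsetD,
      metis distinct.simps(2) list.simps(15) subset_insertI2)
qed auto

text \<open>
  A conjunctive normal form of the statement that two of the listed bits hold: whichever bit of the
  second list is left out, another one holds.
\<close>

primrec two_clauses :: "bool list \<Rightarrow> bool list \<Rightarrow> bool" where
  "two_clauses as [] = True"
| "two_clauses as (b # bs) = (some_true (as @ bs) \<and> two_clauses (as @ [b]) bs)"

lemma some_true_append [simp]: "some_true (as @ bs) \<longleftrightarrow> some_true as \<or> some_true bs"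
  by (induction as) auto

lemma two_true_append [simp]:
  "two_true (as @ bs) \<longleftrightarrow> two_true as \<or> two_true bs \<or> some_true as \<and> some_true bs"
  by (induction as) auto

lemma two_true_imp_some_true: "two_true bs \<Longrightarrow> some_true bs"
  by (induction bs) auto

lemma two_clausesI: "two_true (as @ bs) \<Longrightarrow> two_clauses as bs"
proof (induction bs arbitrary: as)
  case (Cons b bs)
  then show ?case
    using Cons.IH[of "as @ [b]"] by (auto dest: two_true_imp_some_true)
qed simp

text \<open>
  The atoms \<open>agree B x y zs\<close> are left uninterpreted in the propositional problems. They play the role of
  the auxiliary variables that keep the clauses for the lexicographic order short.
\<close>

definition agree :: "('a \<Rightarrow> 'a \<Rightarrow> bool) \<Rightarrow> 'a \<Rightarrow> 'a \<Rightarrow> 'a list \<Rightarrow> bool" where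
  "agree B x y zs \<longleftrightarrow> map (B x) zs = map (B y) zs"

text \<open>Encodes that, if the rows agree on \<open>ps\<close>, the row of \<open>x\<close> over
  \<open>zs\<close> is lexicographically at most that of \<open>y\<close>, where
  \<open>False < True\<close>. The middle clause passes agreement on to the next prefix.\<close>

fun lex_clauses :: "('a \<Rightarrow> 'a \<Rightarrow> bool) \<Rightarrow> 'a \<Rightarrow> 'a \<Rightarrow> 'a list \<Rightarrow> 'a list \<Rightarrow> bool" where
  "lex_clauses B x y ps [] = True"
| "lex_clauses B x y ps (z # zs) =
     ((agree B x y ps \<longrightarrow> B x z \<longrightarrow> B y z) \<and>
      (agree B x y ps \<longrightarrow> B x z = B y z \<longrightarrow> agree B x y (ps @ [z])) \<and>
      lex_clauses B x y (ps @ [z]) zs)"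

lemma agree_Nil [simp]: "agree B x y []"
  by (simp add: agree_def)

lemma lex_clausesI:
  "(agree B x y ps \<longrightarrow> map (B x) zs \<le> map (B y) zs) \<Longrightarrow> lex_clauses B x y ps zs"
proof (induction zs arbitrary: ps)
  case (Cons z zs)
  have "lex_clauses B x y (ps @ [z]) zs"
    using Cons.prems by (intro Cons.IH) (auto simp: agree_def)
  with Cons.prems show ?case
    by (simp add: agree_def) blast
qed simp

section \<open>Transpositions and lexicographically least labellings\<close>

lemma append_le_append_iff:
  fixes us vs :: "'a :: linorder list"
  assumes "length us = length vs"
  shows "us @ xs \<le> vs @ ys \<longleftrightarrow> us < vs \<or> us = vs \<and> xs \<le> ys"
  using assms by (induction us vs rule: list_induct2) auto

text \<open>Compare the upper triangles row by row. In the row of an earlier vertex \<open>u\<close>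
  only \<open>B u a\<close> and \<open>B u b\<close> change places, so the first \<open>u\<close>
  where they differ decides. If there is none, the rows of \<open>a\<close> and \<open>b\<close>
  decide; both begin with the same entry \<open>B a b = B b a\<close> and continue over
  \<open>ws\<close>.\<close>

lemma edge_list_swap_le_imp:
  assumes "symp B" "edge_list B (us @ a # b # ws) \<le> edge_list B (us @ b # a # ws)"
  shows "map (B a) (us @ ws) \<le> map (B b) (us @ ws)"
  using assms(2)
proof (induction us)
  case Nil
  have "B a b = B b a" using assms(1) by (metis sympD)+
  with Nil have "map (B a) ws @ map (B b) ws @ edge_list B ws
      \<le> map (B b) ws @ map (B a) ws @ edge_list B ws"
    by simp
  then show ?case by (subst (asm) append_le_append_iff) (auto simp del: map_eq_conv)
next
  case (Cons u us)
  have sym: "B a u = B u a" "B b u = B u b" using assms(1) by (metis sympD)+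
  have "B u a < B u b \<or> B u a = B u b \<and>
      edge_list B (us @ a # b # ws) \<le> edge_list B (us @ b # a # ws)"
    using Cons.prems by (auto simp: append_le_append_iff)
  then show ?case
    unfolding list.map append_Cons sym Cons_le_Cons using Cons.IH by blast
qed

lemma ex_lex_minimal_labelling:
  assumes "finite W"
  obtains xs where "set xs = W" "distinct xs"
    "\<And>us a b ws. xs = us @ a # b # ws \<Longrightarrow> symp B \<Longrightarrow> lex_clauses B a b [] (us @ ws)"
proof -
  let ?L = "{xs. set xs = W \<and> distinct xs}"
  have fin: "finite ?L"
    by (rule finite_subset[OF _ finite_subset_distinct[OF assms]]) auto
  have ne: "edge_list B ` ?L \<noteq> {}"
    using finite_distinct_list[OF assms] by auto
  obtain xs where xs: "xs \<in> ?L" "Min (edge_list B ` ?L) = edge_list B xs"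
    using Min_in[OF finite_imageI[OF fin, of "edge_list B"] ne] by auto
  have le: "edge_list B xs \<le> edge_list B ys" if "ys \<in> ?L" for ys
    unfolding xs(2)[symmetric] using that by (intro Min_le finite_imageI fin imageI)
  have min: "edge_list B (us @ a # b # ws) \<le> edge_list B (us @ b # a # ws)"
    if "xs = us @ a # b # ws" for us a b ws
    unfolding that[symmetric] by (rule le) (use that xs(1) in auto)
  show thesis
  proof (rule that)
    show "set xs = W" "distinct xs" using xs(1) by auto
    show "lex_clauses B a b [] (us @ ws)" if "xs = us @ a # b # ws" "symp B" for us a b ws
      using edge_list_swap_le_imp[OF that(2) min[OF that(1)]] by (intro lex_clausesI) simp
  qed
qed

definition bits :: "string \<Rightarrow> bool list" where
  "bits s = map (\<lambda>c. c = CHR ''1'') s"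

text \<open>Used as rewrite rules, these equations put the earlier vertex first in every atom, so
  that symmetry of \<open>B\<close> disappears from the propositional problems.\<close>

primrec flips :: "('a \<Rightarrow> 'a \<Rightarrow> bool) \<Rightarrow> 'a list \<Rightarrow> bool" where
  "flips B [] = True"
| "flips B (x # xs) = (list_all (\<lambda>y. B y x = B x y) xs \<and> flips B xs)"

lemma flipsI: "symp B \<Longrightarrow> flips B xs"
  by (induction xs) (auto simp: list_all_iff dest: sympD)

definition clauses :: "('a \<Rightarrow> 'a \<Rightarrow> bool) \<Rightarrow> nat \<Rightarrow> nat \<Rightarrow> 'a list \<Rightarrow> bool" where
  "clauses B k l xs \<longleftrightarrow>
     list_all (\<lambda>ys. some_true (map Not (edge_list B ys))) (choose_list k xs) \<and>
     list_all (\<lambda>ys. two_clauses [] (edge_list B ys)) (choose_list l xs)"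

lemma clausesI:
  assumes "avoids B k l V" "set xs \<subseteq> V" "distinct xs"
  shows "clauses B k l xs"
  using assms choose_listD[of _ k xs] choose_listD[of _ l xs] unfolding clauses_def list_all_iff avoids_def
  by (metis append_Nil subset_trans two_clausesI)

primrec all_pairs :: "('a \<Rightarrow> 'a \<Rightarrow> bool) \<Rightarrow> 'a list \<Rightarrow> bool" where
  "all_pairs R [] = True"
| "all_pairs R (x # xs) = (list_all (R x) xs \<and> all_pairs R xs)"

text \<open>Symmetry breaking for vertices outside \<open>hs\<close>: their order is free, so it can
  be chosen such that their rows towards \<open>hs\<close> increase.\<close>

fun lex_sorted :: "('a \<Rightarrow> 'a \<Rightarrow> bool) \<Rightarrow> 'a list \<Rightarrow> 'a list \<Rightarrow> bool" where
  "lex_sorted B hs (x # y # ys) = (lex_clauses B x y [] hs \<and> lex_sorted B hs (y # ys))"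
| "lex_sorted B hs xs = True"

lemmas eval_rules = eval_nat_numeral BitM.simps numeral_One One_nat_def choose_list.simps
  list.pred_inject list.map append.simps edge_list.simps some_true.simps two_true.simps two_clauses.simps
  all_pairs.simps lex_sorted.simps lex_clauses.simps simp_thms agree_Nil concat.simps

text \<open>
  For a labelling that minimises the upper triangle of the adjacency matrix, transposing two
  consecutive vertices shows that their rows, without the two vertices, are sorted.
\<close>

primrec adjacent_lex :: "('a \<Rightarrow> 'a \<Rightarrow> bool) \<Rightarrow> 'a list \<Rightarrow> 'a list \<Rightarrow> bool" where
  "adjacent_lex B us [] = True"
| "adjacent_lex B us (x # xs) = ((case xs of [] \<Rightarrow> True | y # ys \<Rightarrow> lex_clauses B x y [] (us @ ys)) \<and>
    adjacent_lex B (us @ [x]) xs)"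

lemma ex_adjacent_lex:
  assumes "finite W" "symp B"
  obtains xs where "set xs = W" "distinct xs" "adjacent_lex B [] xs"
proof -
  obtain xs where xs: "set xs = W" "distinct xs"
    and lex: "\<And>us a b ws. xs = us @ a # b # ws \<Longrightarrow> symp B \<Longrightarrow> lex_clauses B a b [] (us @ ws)"
    using ex_lex_minimal_labelling[OF assms(1)] by blast
  have "xs = us @ zs \<Longrightarrow> adjacent_lex B us zs" for us zs
  proof (induction zs arbitrary: us)
    case (Cons z zs)
    then show ?case using lex[OF _ assms(2)] by (auto split: list.split)
  qed simp
  from this[of "[]" xs] show thesis using xs that by blast
qed

text \<open>
  In the following clauses \<open>hs\<close> lists the ten vertices of the known graph and \<open>x\<close>, \<open>y\<close> are further
  vertices. Sets of five vertices that already span two blue edges within \<open>hs\<close> give no clause. In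
  \<open>cone_clauses\<close> there is also a vertex joined to \<open>x\<close> in blue and to \<open>hs\<close> in red.
\<close>

definition cone_clauses :: "('a \<Rightarrow> 'a \<Rightarrow> bool) \<Rightarrow> 'a list \<Rightarrow> 'a \<Rightarrow> bool" where
  "cone_clauses B hs x \<longleftrightarrow> list_all (\<lambda>ts.
     (some_true (edge_list B ts) \<or> some_true (map (B x) ts)) \<and>
     (some_true (map Not (edge_list B ts)) \<or> some_true (map Not (map (B x) ts)))) (choose_list 3 hs)"

text \<open>The first family takes triples of \<open>hs\<close> with exactly one blue edge, so one
  more blue edge must occur among the five vertices. The second keeps a blue edge of
  \<open>hs\<close> from forming a blue \<open>K_4\<close> with \<open>x\<close> and
  \<open>y\<close>.\<close>

definition pair_clauses :: "('a \<Rightarrow> 'a \<Rightarrow> bool) \<Rightarrow> 'a list \<Rightarrow> 'a \<Rightarrow> 'a \<Rightarrow> bool" where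
  "pair_clauses B hs x y \<longleftrightarrow>
     list_all (\<lambda>ts. \<not> some_true (edge_list B ts) \<or> two_true (edge_list B ts) \<or>
       some_true (B x y # map (B x) ts @ map (B y) ts)) (choose_list 3 hs) \<and>
     list_all (\<lambda>ts. \<not> some_true (edge_list B ts) \<or>
       some_true (map Not (B x y # map (B x) ts @ map (B y) ts))) (choose_list 2 hs)"

text \<open>Here a vertex \<open>v\<close> is joined to \<open>hs\<close> in blue and to the triple
  in red. Of its edges to \<open>h\<close> and the triple only \<open>v h\<close> is blue, so a
  second blue edge lies among \<open>h\<close> and the triple; these four must not form a blue
  \<open>K_4\<close> either.\<close>

definition triple_clauses :: "('a \<Rightarrow> 'a \<Rightarrow> bool) \<Rightarrow> 'a list \<Rightarrow> 'a list \<Rightarrow> bool" where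
  "triple_clauses B hs xs \<longleftrightarrow> list_all (\<lambda>h.
     some_true (edge_list B xs @ map (\<lambda>x. B x h) xs) \<and>
     some_true (map Not (edge_list B xs @ map (\<lambda>x. B x h) xs))) hs"

text \<open>Conditions for adding \<open>x\<close> to \<open>hs\<close>: \<open>l\<close> vertices
  of \<open>hs\<close> with no blue edge need two blue edges to \<open>x\<close>, those with exactly
  one need one.\<close>

definition ext_clauses :: "('a \<Rightarrow> 'a \<Rightarrow> bool) \<Rightarrow> nat \<Rightarrow> nat \<Rightarrow> 'a list \<Rightarrow> 'a \<Rightarrow> bool" where
  "ext_clauses B k l hs x \<longleftrightarrow>
     list_all (\<lambda>ts. some_true (map Not (edge_list B ts)) \<or> some_true (map Not (map (B x) ts))) (choose_list k hs) \<and>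
     list_all (\<lambda>ts.
       (two_true (edge_list B ts) \<or> some_true (map (B x) ts)) \<and>
       (some_true (edge_list B ts) \<or> two_clauses [] (map (B x) ts))) (choose_list l hs)"

primrec no_star :: "('a \<Rightarrow> 'a \<Rightarrow> bool) \<Rightarrow> nat \<Rightarrow> 'a list \<Rightarrow> 'a list \<Rightarrow> bool" where
  "no_star B k us [] = True"
| "no_star B k us (x # xs) = (list_all (\<lambda>ts. some_true (map Not (map (B x) ts))) (choose_list k (us @ xs)) \<and>
     no_star B k (us @ [x]) xs)"

section \<open>Propositional case analyses\<close>

text \<open>
  A graph on ten vertices is encoded by the upper triangle of its adjacency matrix, row by row.
\<close>

definition petersen :: "bool list" where
  "petersen = bits ''000000111000110010101010110100000010010100000''"

text \<open>Labelled so that the five pairs of twins, which replace the vertices of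
  \<open>C_5\<close>, are consecutive and in cyclic order.\<close>

definition c5_blowup :: "bool list" where
  "c5_blowup = bits ''011000011110000110110000110000011001100011110''"

definition critical_a :: "bool list" where
  "critical_a = bits ''000001111011100111111100010101110100000110011''"

definition critical_b :: "bool list" where
  "critical_b = bits ''000011111011001111111001001011101011100010100''"

definition critical_c :: "bool list" where
  "critical_c = bits ''000011111011001111111001001011101100011110010''"

definition critical_d :: "bool list" where
  "critical_d = bits ''000011111011001111111001001011101101100010010''"

definition critical_e :: "bool list" where
  "critical_e = bits ''000011111011001111111001001011111100011110010''"

lemmas code_defs = bits_def petersen_def c5_blowup_def critical_a_def critical_b_def critical_c_def critical_d_def critical_e_def

section \<open>Classification on ten vertices\<close>

lemma lex_labelling_3_5:
  assumes "symp B" "clauses B 3 5 [a0, a1, a2, a3, a4, a5, a6, a7, a8, a9]"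
    "adjacent_lex B [] [a0, a1, a2, a3, a4, a5, a6, a7, a8, a9]"
  shows "edge_list B [a0, a1, a2, a3, a4, a5, a6, a7, a8, a9] \<in> set (map bits [''000000111000110010101010110100000010010100000'',
    ''000001111000011110110011110011011001100000000''])"
proof (rule ccontr)
  note [simp] = bits_def flipsI[OF assms(1), of "[a0, a1, a2, a3, a4, a5, a6, a7, a8, a9]", simplified]
  assume neg: "\<not> ?thesis"
  \<comment> \<open>Each listed code is thereby excluded by a constraint on the 45 atoms.\<close>
  note neg' = neg[simplified]
  note c = assms(2)[simplified clauses_def eval_rules]
  note l = assms(3)[simplified]
  show False using c l neg' by sat
qed

text \<open>Sorted consecutive rows break the symmetry only in part, so one graph may occur under
  several codes; \<open>labelling_4_4\<close> reduces the 23 codes to five.\<close>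

lemma lex_labelling_4_4:
  assumes "symp B" "clauses B 4 4 [a0, a1, a2, a3, a4, a5, a6, a7, a8, a9]"
    "adjacent_lex B [] [a0, a1, a2, a3, a4, a5, a6, a7, a8, a9]"
  shows "edge_list B [a0, a1, a2, a3, a4, a5, a6, a7, a8, a9] \<in> set (map bits [''000001111011100111111100010101110100000110011'',
    ''000011111011000111111100100101010101100010011'',
    ''000011111011001111111000101001100101010001110'',
    ''000011111011001111111001001011101011100010100'',
    ''000011111011001111111001001011101100011110010'',
    ''000011111011001111111001001011101101100010010'',
    ''000011111011001111111001001011111000011110010'',
    ''000011111011001111111001001011111000101010100'',
    ''000011111011001111111001001011111100011100010'',
    ''000011111011001111111001001011111100011110010'',
    ''000011111011001111111001001110100110110011010'',
    ''000011111011001111111001001110100111010100010'',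
    ''000011111011001111111001101010101000101011100'',
    ''000011111011001111111001101010101000101110001'',
    ''000011111011001111111001101010101000110011010'',
    ''000011111011001111111001101010101001100010011'',
    ''000011111011001111111011001101101100101110000'',
    ''000011111011001111111011001101101100101110001'',
    ''000011111011011111110011010101110101100001100'',
    ''000011111011011111110011010101110101100001101'',
    ''000111111010011111110011111100001011010001100'',
    ''000111111010011111110011111100001011010001101'',
    ''000111111110011111110011111100001011010001100''])"
proof (rule ccontr)
  note [simp] = bits_def flipsI[OF assms(1), of "[a0, a1, a2, a3, a4, a5, a6, a7, a8, a9]", simplified]
  assume neg: "\<not> ?thesis"
  note neg' = neg[simplified]
  note c = assms(2)[simplified clauses_def eval_rules]
  note l = assms(3)[simplified]
  show False using c l neg' by sat
qed

section \<open>Gluing further vertices to the ten-vertex graphs\<close>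

lemma critical_a_no_gluing:
  assumes "edge_list B [a0, a1, a2, a3, a4, a5, a6, a7, a8, a9] = critical_a"
    "list_all (cone_clauses B [a0, a1, a2, a3, a4, a5, a6, a7, a8, a9]) [x0, x1, x2, x3, x4, x5, x6, x7]"
    "all_pairs (pair_clauses B [a0, a1, a2, a3, a4, a5, a6, a7, a8, a9]) [x0, x1, x2, x3, x4, x5, x6, x7]"
    "lex_sorted B [a0, a1, a2, a3, a4, a5, a6, a7, a8, a9] [x0, x1, x2, x3, x4, x5, x6, x7]"
    "list_all (\<lambda>ts. some_true (map Not (edge_list B ts))) (choose_list 3 [x0, x1, x2, x3, x4, x5, x6, x7])"
    "list_all (\<lambda>ts. two_clauses (edge_list B ts) (concat (map (\<lambda>x. [B x a2, B x a9]) ts))) (choose_list 3 [x0, x1, x2, x3, x4, x5, x6, x7])"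
    "list_all (\<lambda>ts. two_clauses (edge_list B ts) (concat (map (\<lambda>x. [B x a4, B x a9]) ts))) (choose_list 3 [x0, x1, x2, x3, x4, x5, x6, x7])"
  shows False
proof -
  note m = assms(1)[unfolded code_defs, simplified]
  note c = cone_clauses_def[of B "[a0, a1, a2, a3, a4, a5, a6, a7, a8, a9]", simplified eval_rules m]
  note p = pair_clauses_def[of B "[a0, a1, a2, a3, a4, a5, a6, a7, a8, a9]", simplified eval_rules m]
  note a = assms(2-)[simplified eval_rules c p]
  show False using a by sat
qed

lemma critical_b_no_gluing:
  assumes "edge_list B [a0, a1, a2, a3, a4, a5, a6, a7, a8, a9] = critical_b"
    "list_all (cone_clauses B [a0, a1, a2, a3, a4, a5, a6, a7, a8, a9]) [x0, x1, x2, x3, x4, x5, x6, x7]"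
    "all_pairs (pair_clauses B [a0, a1, a2, a3, a4, a5, a6, a7, a8, a9]) [x0, x1, x2, x3, x4, x5, x6, x7]"
    "lex_sorted B [a0, a1, a2, a3, a4, a5, a6, a7, a8, a9] [x0, x1, x2, x3, x4, x5, x6, x7]"
    "list_all (\<lambda>ts. some_true (map Not (edge_list B ts))) (choose_list 3 [x0, x1, x2, x3, x4, x5, x6, x7])"
    "list_all (\<lambda>ts. two_clauses (edge_list B ts) (concat (map (\<lambda>x. [B x a2, B x a8]) ts))) (choose_list 3 [x0, x1, x2, x3, x4, x5, x6, x7])"
    "list_all (\<lambda>ts. two_clauses (edge_list B ts) (concat (map (\<lambda>x. [B x a4, B x a8]) ts))) (choose_list 3 [x0, x1, x2, x3, x4, x5, x6, x7])"
  shows False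
proof -
  note m = assms(1)[unfolded code_defs, simplified]
  note c = cone_clauses_def[of B "[a0, a1, a2, a3, a4, a5, a6, a7, a8, a9]", simplified eval_rules m]
  note p = pair_clauses_def[of B "[a0, a1, a2, a3, a4, a5, a6, a7, a8, a9]", simplified eval_rules m]
  note a = assms(2-)[simplified eval_rules c p]
  show False using a by sat
qed

lemma critical_c_no_gluing:
  assumes "edge_list B [a0, a1, a2, a3, a4, a5, a6, a7, a8, a9] = critical_c"
    "list_all (cone_clauses B [a0, a1, a2, a3, a4, a5, a6, a7, a8, a9]) [x0, x1, x2, x3, x4, x5, x6, x7]"
    "all_pairs (pair_clauses B [a0, a1, a2, a3, a4, a5, a6, a7, a8, a9]) [x0, x1, x2, x3, x4, x5, x6, x7]"
    "lex_sorted B [a0, a1, a2, a3, a4, a5, a6, a7, a8, a9] [x0, x1, x2, x3, x4, x5, x6, x7]"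
    "list_all (\<lambda>ts. some_true (map Not (edge_list B ts))) (choose_list 3 [x0, x1, x2, x3, x4, x5, x6, x7])"
  shows False
proof -
  note m = assms(1)[unfolded code_defs, simplified]
  note c = cone_clauses_def[of B "[a0, a1, a2, a3, a4, a5, a6, a7, a8, a9]", simplified eval_rules m]
  note p = pair_clauses_def[of B "[a0, a1, a2, a3, a4, a5, a6, a7, a8, a9]", simplified eval_rules m]
  note a = assms(2-)[simplified eval_rules c p]
  show False using a by sat
qed

lemma critical_d_no_gluing:
  assumes "edge_list B [a0, a1, a2, a3, a4, a5, a6, a7, a8, a9] = critical_d"
    "list_all (cone_clauses B [a0, a1, a2, a3, a4, a5, a6, a7, a8, a9]) [x0, x1, x2, x3, x4, x5, x6, x7]"
    "all_pairs (pair_clauses B [a0, a1, a2, a3, a4, a5, a6, a7, a8, a9]) [x0, x1, x2, x3, x4, x5, x6, x7]"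
    "lex_sorted B [a0, a1, a2, a3, a4, a5, a6, a7, a8, a9] [x0, x1, x2, x3, x4, x5, x6, x7]"
    "list_all (\<lambda>ts. some_true (map Not (edge_list B ts))) (choose_list 3 [x0, x1, x2, x3, x4, x5, x6, x7])"
  shows False
proof -
  note m = assms(1)[unfolded code_defs, simplified]
  note c = cone_clauses_def[of B "[a0, a1, a2, a3, a4, a5, a6, a7, a8, a9]", simplified eval_rules m]
  note p = pair_clauses_def[of B "[a0, a1, a2, a3, a4, a5, a6, a7, a8, a9]", simplified eval_rules m]
  note a = assms(2-)[simplified eval_rules c p]
  show False using a by sat
qed

lemma critical_e_no_gluing:
  assumes "edge_list B [a0, a1, a2, a3, a4, a5, a6, a7, a8, a9] = critical_e"
    "list_all (cone_clauses B [a0, a1, a2, a3, a4, a5, a6, a7, a8, a9]) [x0, x1, x2, x3, x4, x5, x6, x7]"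
    "all_pairs (pair_clauses B [a0, a1, a2, a3, a4, a5, a6, a7, a8, a9]) [x0, x1, x2, x3, x4, x5, x6, x7]"
    "lex_sorted B [a0, a1, a2, a3, a4, a5, a6, a7, a8, a9] [x0, x1, x2, x3, x4, x5, x6, x7]"
    "list_all (\<lambda>ts. some_true (map Not (edge_list B ts))) (choose_list 3 [x0, x1, x2, x3, x4, x5, x6, x7])"
  shows False
proof -
  note m = assms(1)[unfolded code_defs, simplified]
  note c = cone_clauses_def[of B "[a0, a1, a2, a3, a4, a5, a6, a7, a8, a9]", simplified eval_rules m]
  note p = pair_clauses_def[of B "[a0, a1, a2, a3, a4, a5, a6, a7, a8, a9]", simplified eval_rules m]
  note a = assms(2-)[simplified eval_rules c p]
  show False using a by sat
qed

text \<open>For \<open>hs\<close> the blue neighbourhood of a vertex and \<open>x\<close>,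
  \<open>y\<close>, \<open>z\<close> red neighbours of it. Seven red neighbours always contain a
  blue triangle, by \<open>blue_triangle_7\<close>, so the Petersen graph is excluded.\<close>

lemma petersen_no_blue_triangle:
  assumes "edge_list B [a0, a1, a2, a3, a4, a5, a6, a7, a8, a9] = petersen"
    "list_all (ext_clauses B 3 4 [a0, a1, a2, a3, a4, a5, a6, a7, a8, a9]) [x, y, z]"
    "all_pairs (pair_clauses B [a0, a1, a2, a3, a4, a5, a6, a7, a8, a9]) [x, y, z]"
    "triple_clauses B [a0, a1, a2, a3, a4, a5, a6, a7, a8, a9] [x, y, z]" "B x y" "B x z" "B y z"
  shows False
proof -
  note m = assms(1)[unfolded code_defs, simplified]
  note c = ext_clauses_def[of B 3 4 "[a0, a1, a2, a3, a4, a5, a6, a7, a8, a9]", simplified eval_rules m]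
  note p = pair_clauses_def[of B "[a0, a1, a2, a3, a4, a5, a6, a7, a8, a9]", simplified eval_rules m]
  note t = triple_clauses_def[of B "[a0, a1, a2, a3, a4, a5, a6, a7, a8, a9]", simplified eval_rules m]
  note a = assms(2-)[simplified eval_rules c p t]
  show False using a by sat
qed

text \<open>Among eight red neighbours some \<open>x0\<close> is the centre of a blue star with four
  leaves, by \<open>blue_star_8\<close>. Once \<open>x0\<close> meets each twin pair in exactly one
  vertex, exchanging twins fixes its row completely, which is the form
  \<open>c5_blowup_no_star\<close> starts from.\<close>

lemma c5_blowup_star_transversal:
  assumes "edge_list B [a0, a1, a2, a3, a4, a5, a6, a7, a8, a9] = c5_blowup"
    "list_all (ext_clauses B 3 4 [a0, a1, a2, a3, a4, a5, a6, a7, a8, a9]) [x0, x1, x2, x3, x4]"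
    "all_pairs (pair_clauses B [a0, a1, a2, a3, a4, a5, a6, a7, a8, a9]) [x0, x1, x2, x3, x4]"
    "list_all (triple_clauses B [a0, a1, a2, a3, a4, a5, a6, a7, a8, a9]) (choose_list 3 [x0, x1, x2, x3, x4])"
    "lex_sorted B [a0, a1, a2, a3, a4, a5, a6, a7, a8, a9] [x1, x2, x3, x4]"
    "list_all (B x0) [x1, x2, x3, x4]"
  shows "B x0 a0 \<noteq> B x0 a1 \<and> B x0 a2 \<noteq> B x0 a3 \<and>
      B x0 a4 \<noteq> B x0 a5 \<and> B x0 a6 \<noteq> B x0 a7 \<and> B x0 a8 \<noteq> B x0 a9"
proof (rule ccontr)
  assume n: "\<not> ?thesis"
  note m = assms(1)[unfolded code_defs, simplified]
  note c = ext_clauses_def[of B 3 4 "[a0, a1, a2, a3, a4, a5, a6, a7, a8, a9]", simplified eval_rules m]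
  note p = pair_clauses_def[of B "[a0, a1, a2, a3, a4, a5, a6, a7, a8, a9]", simplified eval_rules m]
  note t = triple_clauses_def[of B "[a0, a1, a2, a3, a4, a5, a6, a7, a8, a9]", simplified eval_rules m]
  note a = assms(2-)[simplified eval_rules clauses_def c p t]
  show False using a n by sat
qed

text \<open>\<open>x0\<close> is the star centre and \<open>x1\<close> to \<open>x4\<close> are its
  leaves; leaves and remaining vertices are sorted separately, since only permutations within each
  group preserve these roles.\<close>

lemma c5_blowup_no_star:
  assumes "edge_list B [a0, a1, a2, a3, a4, a5, a6, a7, a8, a9] = c5_blowup"
    "list_all (ext_clauses B 3 4 [a0, a1, a2, a3, a4, a5, a6, a7, a8, a9]) [x0, x1, x2, x3, x4, x5, x6]"
    "all_pairs (pair_clauses B [a0, a1, a2, a3, a4, a5, a6, a7, a8, a9]) [x0, x1, x2, x3, x4, x5, x6]"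
    "list_all (triple_clauses B [a0, a1, a2, a3, a4, a5, a6, a7, a8, a9]) (choose_list 3 [x0, x1, x2, x3, x4, x5, x6])"
    "lex_sorted B [a0, a1, a2, a3, a4, a5, a6, a7, a8, a9] [x1, x2, x3, x4]"
    "lex_sorted B [a0, a1, a2, a3, a4, a5, a6, a7, a8, a9] [x5, x6]"
    "list_all (B x0) [x1, x2, x3, x4]"
    "clauses B 4 4 [x0, x1, x2, x3, x4, x5, x6]" "B x0 a0" "\<not> B x0 a1" "B x0 a2" "\<not> B x0 a3"
    "B x0 a4" "\<not> B x0 a5" "B x0 a6" "\<not> B x0 a7" "B x0 a8" "\<not> B x0 a9"
  shows "False"
proof (rule ccontr)
  assume n: "\<not> ?thesis"
  note m = assms(1)[unfolded code_defs, simplified]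
  note c = ext_clauses_def[of B 3 4 "[a0, a1, a2, a3, a4, a5, a6, a7, a8, a9]", simplified eval_rules m]
  note p = pair_clauses_def[of B "[a0, a1, a2, a3, a4, a5, a6, a7, a8, a9]", simplified eval_rules m]
  note t = triple_clauses_def[of B "[a0, a1, a2, a3, a4, a5, a6, a7, a8, a9]", simplified eval_rules m]
  note a = assms(2-)[simplified eval_rules clauses_def c p t]
  show False using a n by sat
qed

text \<open>This is the bound \<open>r(K_3, K_4 - e) \<le> 7\<close>.\<close>

lemma blue_triangle_7:
  assumes "clauses B 4 4 [x0, x1, x2, x3, x4, x5, x6]"
    "list_all (\<lambda>ts. some_true (map Not (edge_list B ts))) (choose_list 3 [x0, x1, x2, x3, x4, x5, x6])"
  shows False
  using assms[simplified clauses_def eval_rules] by sat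

lemma blue_star_8:
  assumes "symp B" "clauses B 4 4 [x0, x1, x2, x3, x4, x5, x6, x7]"
    "adjacent_lex B [] [x0, x1, x2, x3, x4, x5, x6, x7]"
    "no_star B 4 [] [x0, x1, x2, x3, x4, x5, x6, x7]"
  shows False
proof -
  note [simp] = flipsI[OF assms(1), of "[x0, x1, x2, x3, x4, x5, x6, x7]", simplified]
  note c = assms(2)[simplified clauses_def eval_rules]
  note l = assms(3)[simplified]
  note n = assms(4)[simplified no_star.simps eval_rules]
  show False using c l n by sat
qed

section \<open>Maximality of the ten-vertex graphs\<close>

lemma petersen_maximal:
  assumes "edge_list B [a0, a1, a2, a3, a4, a5, a6, a7, a8, a9] = petersen"
    "ext_clauses B 2 4 [a0, a1, a2, a3, a4, a5, a6, a7, a8, a9] x"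
  shows False
proof -
  note m = assms(1)[unfolded code_defs, simplified]
  note c = ext_clauses_def[of B 2 4 "[a0, a1, a2, a3, a4, a5, a6, a7, a8, a9]", simplified eval_rules m]
  show False using assms(2)[simplified eval_rules c] by sat
qed

lemma c5_blowup_maximal:
  assumes "edge_list B [a0, a1, a2, a3, a4, a5, a6, a7, a8, a9] = c5_blowup"
    "ext_clauses B 2 4 [a0, a1, a2, a3, a4, a5, a6, a7, a8, a9] x"
  shows False
proof -
  note m = assms(1)[unfolded code_defs, simplified]
  note c = ext_clauses_def[of B 2 4 "[a0, a1, a2, a3, a4, a5, a6, a7, a8, a9]", simplified eval_rules m]
  show False using assms(2)[simplified eval_rules c] by sat
qed

lemma critical_a_maximal:
  assumes "edge_list B [a0, a1, a2, a3, a4, a5, a6, a7, a8, a9] = critical_a"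
    "ext_clauses B 3 3 [a0, a1, a2, a3, a4, a5, a6, a7, a8, a9] x"
  shows False
proof -
  note m = assms(1)[unfolded code_defs, simplified]
  note c = ext_clauses_def[of B 3 3 "[a0, a1, a2, a3, a4, a5, a6, a7, a8, a9]", simplified eval_rules m]
  show False using assms(2)[simplified eval_rules c] by sat
qed

lemma critical_b_maximal:
  assumes "edge_list B [a0, a1, a2, a3, a4, a5, a6, a7, a8, a9] = critical_b"
    "ext_clauses B 3 3 [a0, a1, a2, a3, a4, a5, a6, a7, a8, a9] x"
  shows False
proof -
  note m = assms(1)[unfolded code_defs, simplified]
  note c = ext_clauses_def[of B 3 3 "[a0, a1, a2, a3, a4, a5, a6, a7, a8, a9]", simplified eval_rules m]
  show False using assms(2)[simplified eval_rules c] by sat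
qed

lemma critical_c_maximal:
  assumes "edge_list B [a0, a1, a2, a3, a4, a5, a6, a7, a8, a9] = critical_c"
    "ext_clauses B 3 3 [a0, a1, a2, a3, a4, a5, a6, a7, a8, a9] x"
  shows False
proof -
  note m = assms(1)[unfolded code_defs, simplified]
  note c = ext_clauses_def[of B 3 3 "[a0, a1, a2, a3, a4, a5, a6, a7, a8, a9]", simplified eval_rules m]
  show False using assms(2)[simplified eval_rules c] by sat
qed

lemma critical_d_maximal:
  assumes "edge_list B [a0, a1, a2, a3, a4, a5, a6, a7, a8, a9] = critical_d"
    "ext_clauses B 3 3 [a0, a1, a2, a3, a4, a5, a6, a7, a8, a9] x"
  shows False
proof -
  note m = assms(1)[unfolded code_defs, simplified]
  note c = ext_clauses_def[of B 3 3 "[a0, a1, a2, a3, a4, a5, a6, a7, a8, a9]", simplified eval_rules m]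
  show False using assms(2)[simplified eval_rules c] by sat
qed

lemma critical_e_maximal:
  assumes "edge_list B [a0, a1, a2, a3, a4, a5, a6, a7, a8, a9] = critical_e"
    "ext_clauses B 3 3 [a0, a1, a2, a3, a4, a5, a6, a7, a8, a9] x"
  shows False
proof -
  note m = assms(1)[unfolded code_defs, simplified]
  note c = ext_clauses_def[of B 3 3 "[a0, a1, a2, a3, a4, a5, a6, a7, a8, a9]", simplified eval_rules m]
  show False using assms(2)[simplified eval_rules c] by sat
qed

section \<open>Clauses from forbidden subgraphs\<close>

lemma some_true_iff: "some_true bs \<longleftrightarrow> (\<exists>b\<in>set bs. b)"
  by (induction bs) auto

lemma avoidsD:
  assumes "avoids B k l V" "distinct xs" "set xs \<subseteq> V"
  shows "length xs = k \<Longrightarrow> some_true (map Not (edge_list B xs))"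
    and "length xs = l \<Longrightarrow> two_true (edge_list B xs)"
  using assms by (auto simp: avoids_def)

definition nbhd :: "('a \<Rightarrow> 'a \<Rightarrow> bool) \<Rightarrow> 'a set \<Rightarrow> 'a \<Rightarrow> 'a set" where
  "nbhd B V v = {u \<in> V. u \<noteq> v \<and> B v u}"

definition conbhd :: "('a \<Rightarrow> 'a \<Rightarrow> bool) \<Rightarrow> 'a set \<Rightarrow> 'a \<Rightarrow> 'a set" where
  "conbhd B V v = {u \<in> V. u \<noteq> v \<and> \<not> B v u}"

lemma card_nbhd_conbhd:
  assumes "finite V" "v \<in> V"
  shows "card (nbhd B V v) + card (conbhd B V v) = card V - 1"
proof -
  have "nbhd B V v \<union> conbhd B V v = V - {v}" "nbhd B V v \<inter> conbhd B V v = {}"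
    by (auto simp: nbhd_def conbhd_def)
  moreover have "finite (nbhd B V v)" "finite (conbhd B V v)"
    using assms(1) by (auto simp: nbhd_def conbhd_def)
  ultimately show ?thesis
    using card_Un_disjoint[of "nbhd B V v" "conbhd B V v"] assms by simp
qed

lemma avoids_nbhd:
  assumes "avoids B (Suc k) l V" "v \<in> V"
  shows "avoids B k l (nbhd B V v)"
  unfolding avoids_def
proof (intro allI impI conjI)
  fix xs assume xs: "distinct xs \<and> set xs \<subseteq> nbhd B V v"
  then have v: "distinct (v # xs)" "set (v # xs) \<subseteq> V" and "set xs \<subseteq> V" and "\<forall>x\<in>set xs. B v x"
    using assms(2) by (auto simp: nbhd_def)
  then have *: "\<not> some_true (map Not (map (B v) xs))"
    by (auto simp: some_true_iff)
  show "some_true (map Not (edge_list B xs))" if "length xs = k"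
    using avoidsD(1)[OF assms(1) v] that * by simp
  show "two_true (edge_list B xs)" if "length xs = l"
    using avoidsD(2)[OF assms(1) _ \<open>set xs \<subseteq> V\<close>] that xs by simp
qed

text \<open>Adding \<open>v\<close> to \<open>l\<close> of its red neighbours adds no blue edge, so
  these already span two.\<close>

lemma avoids_conbhd:
  assumes "avoids B k (Suc l) V" "v \<in> V"
  shows "avoids B k l (conbhd B V v)"
  unfolding avoids_def
proof (intro allI impI conjI)
  fix xs assume xs: "distinct xs \<and> set xs \<subseteq> conbhd B V v"
  then have v: "distinct (v # xs)" "set (v # xs) \<subseteq> V" and "set xs \<subseteq> V" and "\<forall>x\<in>set xs. \<not> B v x"
    using assms(2) by (auto simp: conbhd_def)
  then have *: "\<not> some_true (map (B v) xs)"
    by (auto simp: some_true_iff)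
  show "some_true (map Not (edge_list B xs))" if "length xs = k"
    using avoidsD(1)[OF assms(1) _ \<open>set xs \<subseteq> V\<close>] that xs by simp
  show "two_true (edge_list B xs)" if "length xs = l"
    using avoidsD(2)[OF assms(1) v] that * two_true_imp_some_true by auto
qed

lemma ext_clausesI:
  assumes "avoids B (Suc k) (Suc l) V" "distinct (x # hs)" "set (x # hs) \<subseteq> V"
  shows "ext_clauses B k l hs x"
  unfolding ext_clauses_def list_all_iff
proof (intro conjI ballI)
  fix ts assume ts: "ts \<in> set (choose_list k hs)"
  then have "distinct (x # ts)" "set (x # ts) \<subseteq> V" "length (x # ts) = Suc k"
    using choose_listD[OF ts] assms by auto
  from avoidsD(1)[OF assms(1) this]
  show "some_true (map Not (edge_list B ts)) \<or> some_true (map Not (map (B x) ts))"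
    by auto
next
  fix ts assume ts: "ts \<in> set (choose_list l hs)"
  then have "distinct (x # ts)" "set (x # ts) \<subseteq> V" "length (x # ts) = Suc l"
    using choose_listD[OF ts] assms by auto
  from avoidsD(2)[OF assms(1) this]
  have two: "two_true (map (B x) ts @ edge_list B ts)"
    by simp
  then show "two_true (edge_list B ts) \<or> some_true (map (B x) ts)"
    using two_true_imp_some_true by auto
  from two show "some_true (edge_list B ts) \<or> two_clauses [] (map (B x) ts)"
    using two_true_imp_some_true two_clausesI[of "[]"] by auto
qed

text \<open>Among \<open>v\<close>, \<open>x\<close> and three vertices of \<open>hs\<close>, the
  only edge at \<open>v\<close> that can be blue is \<open>v x\<close>; hence a second blue edge
  lies among \<open>x\<close> and the three.\<close>

lemma cone_clausesI:
  assumes "avoids B 4 5 V" "distinct (v # x # hs)" "set (v # x # hs) \<subseteq> V" "\<forall>h\<in>set hs. \<not> B v h"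
  shows "cone_clauses B hs x"
  unfolding cone_clauses_def list_all_iff
proof (intro conjI ballI)
  fix ts assume ts: "ts \<in> set (choose_list 3 hs)"
  have "\<not> some_true (map (B v) ts)"
    using choose_listD[OF ts] assms(4) by (auto simp: some_true_iff)
  moreover have "two_true (edge_list B (v # x # ts))"
    using choose_listD[OF ts] assms by (intro avoidsD(2)[OF assms(1)]) auto
  ultimately show "some_true (edge_list B ts) \<or> some_true (map (B x) ts)"
    using two_true_imp_some_true by auto
  have "some_true (map Not (edge_list B (x # ts)))"
    using choose_listD[OF ts] assms by (intro avoidsD(1)[OF assms(1)]) auto
  then show "some_true (map Not (edge_list B ts)) \<or> some_true (map Not (map (B x) ts))"
    by auto
qed

lemma pair_clausesI:
  assumes "avoids B 4 5 V" "distinct (x # y # hs)" "set (x # y # hs) \<subseteq> V"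
  shows "pair_clauses B hs x y"
  unfolding pair_clauses_def list_all_iff
proof (intro conjI ballI)
  fix ts assume ts: "ts \<in> set (choose_list 3 hs)"
  have "two_true (edge_list B (x # y # ts))"
    using choose_listD[OF ts] assms by (intro avoidsD(2)[OF assms(1)]) auto
  then show "\<not> some_true (edge_list B ts) \<or> two_true (edge_list B ts) \<or>
      some_true (B x y # map (B x) ts @ map (B y) ts)"
    using two_true_imp_some_true by auto
next
  fix ts assume ts: "ts \<in> set (choose_list 2 hs)"
  then obtain p q where pq: "ts = [p, q]"
    using choose_listD[OF ts] by (auto simp: numeral_eq_Suc length_Suc_conv)
  have "some_true (map Not (edge_list B (x # y # ts)))"
    using choose_listD[OF ts] assms by (intro avoidsD(1)[OF assms(1)]) auto
  then show "\<not> some_true (edge_list B ts) \<or>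
      some_true (map Not (B x y # map (B x) ts @ map (B y) ts))"
    by (auto simp: pq)
qed

lemma triple_clausesI:
  assumes "avoids B 4 5 V" "distinct (v # hs @ [x, y, z])" "set (v # hs @ [x, y, z]) \<subseteq> V"
    "\<forall>h\<in>set hs. B v h" "\<not> B v x" "\<not> B v y" "\<not> B v z"
  shows "triple_clauses B hs [x, y, z]"
  unfolding triple_clauses_def list_all_iff
proof (intro ballI)
  fix h assume h: "h \<in> set hs"
  have "two_true (edge_list B [v, x, y, z, h])"
    using assms h by (intro avoidsD(2)[OF assms(1)]) auto
  moreover have "some_true (map Not (edge_list B [x, y, z, h]))"
    using assms h by (intro avoidsD(1)[OF assms(1)]) auto
  ultimately show "some_true (edge_list B [x, y, z] @ map (\<lambda>x. B x h) [x, y, z]) \<and>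
      some_true (map Not (edge_list B [x, y, z] @ map (\<lambda>x. B x h) [x, y, z]))"
    using assms h by auto
qed

text \<open>With \<open>a b\<close> red, the two blue edges lie among the triple and its six edges
  to \<open>a\<close> and \<open>b\<close>. Only clauses leaving out one of these six edges are
  produced, so the problems stay small.\<close>

lemma red_pair_clauses:
  assumes "avoids B 4 5 V" "distinct (a # b # xs)" "set (a # b # xs) \<subseteq> V" "\<not> B a b"
  shows "list_all (\<lambda>ts. two_clauses (edge_list B ts) (concat (map (\<lambda>x. [B x a, B x b]) ts)))
    (choose_list 3 xs)"
  unfolding list_all_iff
proof (intro ballI)
  fix ts assume ts: "ts \<in> set (choose_list 3 xs)"
  then obtain x y z where xyz: "ts = [x, y, z]"
    using choose_listD[OF ts] by (auto simp: numeral_eq_Suc length_Suc_conv)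
  have "two_true (edge_list B [x, y, z, a, b])"
    using choose_listD[OF ts] assms xyz by (intro avoidsD(2)[OF assms(1)]) auto
  then show "two_clauses (edge_list B ts) (concat (map (\<lambda>x. [B x a, B x b]) ts))"
    using assms(4) unfolding xyz by (intro two_clausesI) auto
qed

lemma all_pairsI:
  assumes "distinct xs" "\<And>x y. x \<in> set xs \<Longrightarrow> y \<in> set xs \<Longrightarrow> x \<noteq> y \<Longrightarrow> R x y"
  shows "all_pairs R xs"
  using assms by (induction xs) (auto simp: list_all_iff)

lemma ex_lex_sorted:
  assumes "finite W"
  obtains xs where "set xs = W" "distinct xs" "lex_sorted B hs xs"
proof -
  obtain ys where ys: "set ys = W" "distinct ys"
    using finite_distinct_list[OF assms] by blast
  have "sorted (map (\<lambda>x. map (B x) hs) xs) \<Longrightarrow> lex_sorted B hs xs" for xs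
    by (induction B hs xs rule: lex_sorted.induct) (auto intro!: lex_clausesI)
  from this[OF sorted_sort_key] show thesis
    using ys by (intro that[of "sort_key (\<lambda>x. map (B x) hs) ys"]) auto
qed

lemma no_starI:
  assumes "distinct (us @ xs)"
    "\<And>x ts. x \<in> set (us @ xs) \<Longrightarrow> distinct (x # ts) \<Longrightarrow> length ts = k \<Longrightarrow> set ts \<subseteq> set (us @ xs) \<Longrightarrow>
       \<not> list_all (B x) ts"
  shows "no_star B k us xs"
  using assms
proof (induction xs arbitrary: us)
  case (Cons x xs)
  have "some_true (map Not (map (B x) ts))" if "ts \<in> set (choose_list k (us @ xs))" for ts
    using choose_listD[OF that] Cons.prems(1) Cons.prems(2)[of x ts]
    by (auto simp: some_true_iff list_all_iff)
  moreover have "no_star B k (us @ [x]) xs"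
    using Cons.prems by (intro Cons.IH) auto
  ultimately show ?case by (simp add: list_all_iff)
qed simp

lemma length_7E:
  assumes "length xs = 7"
  obtains x0 x1 x2 x3 x4 x5 x6 where "xs = [x0, x1, x2, x3, x4, x5, x6]"
  using assms by (auto simp: numeral_eq_Suc length_Suc_conv)

lemma length_8E:
  assumes "length xs = 8"
  obtains x0 x1 x2 x3 x4 x5 x6 x7 where "xs = [x0, x1, x2, x3, x4, x5, x6, x7]"
  using assms by (auto simp: numeral_eq_Suc length_Suc_conv)

lemma length_10E:
  assumes "length xs = 10"
  obtains a0 a1 a2 a3 a4 a5 a6 a7 a8 a9 where "xs = [a0, a1, a2, a3, a4, a5, a6, a7, a8, a9]"
  using assms by (auto simp: numeral_eq_Suc length_Suc_conv)

section \<open>Extremal neighbourhoods\<close>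

lemma labelling_3_5:
  assumes "symp B" "avoids B 3 5 W" "finite W" "card W = 10"
  obtains hs where "set hs = W" "distinct hs"
    "edge_list B hs \<in> {petersen, c5_blowup}"
proof -
  note thesisI = that
  obtain xs where xs: "set xs = W" "distinct xs" "adjacent_lex B [] xs"
    using ex_adjacent_lex[OF assms(3,1)] by blast
  have "length xs = 10"
    using xs(1,2) assms(4) distinct_card by fastforce
  then obtain a0 a1 a2 a3 a4 a5 a6 a7 a8 a9 where eq: "xs = [a0, a1, a2, a3, a4, a5, a6, a7, a8, a9]"
    by (rule length_10E)
  note flip = flipsI[OF assms(1), of xs, unfolded eq, simplified]
  have "clauses B 3 5 xs"
    using clausesI[OF assms(2)] xs by simp
  then have "edge_list B [a0, a1, a2, a3, a4, a5, a6, a7, a8, a9] \<in> set (map bits [''000000111000110010101010110100000010010100000'',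
      ''000001111000011110110011110011011001100000000''])"
    using lex_labelling_3_5[OF assms(1)] xs(3) unfolding eq by blast
  moreover have relabel: thesis if "edge_list B hs = r" "r \<in> {petersen, c5_blowup}"
    "set hs = set xs" "distinct hs" for hs r
    using that xs(1) by (intro thesisI[of hs]) auto
  ultimately show thesis
    unfolding list.map list.set insert_iff empty_iff
  proof (elim disjE)
    assume "edge_list B [a0, a1, a2, a3, a4, a5, a6, a7, a8, a9] = bits ''000000111000110010101010110100000010010100000''"
    then show thesis
      using xs(2) by (intro relabel[of "[a0, a1, a2, a3, a4, a5, a6, a7, a8, a9]" petersen]) (auto simp: eq flip code_defs)
  next
    assume "edge_list B [a0, a1, a2, a3, a4, a5, a6, a7, a8, a9] = bits ''000001111000011110110011110011011001100000000''"
    \<comment> \<open>This order runs through the twin pairs along the pentagon.\<close>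
    then show thesis
      using xs(2) by (intro relabel[of "[a0, a1, a6, a7, a4, a5, a2, a3, a8, a9]" c5_blowup]) (auto simp: eq flip code_defs)
  qed (rule FalseE)
qed

text \<open>Each code from \<open>lex_labelling_4_4\<close> is carried to one of the five named
  codes by an explicit permutation, given as argument to \<open>relabel\<close>.\<close>

lemma labelling_4_4:
  assumes "symp B" "avoids B 4 4 W" "finite W" "card W = 10"
  obtains hs where "set hs = W" "distinct hs"
    "edge_list B hs \<in> {critical_a, critical_b, critical_c, critical_d, critical_e}"
proof -
  note thesisI = that
  obtain xs where xs: "set xs = W" "distinct xs" "adjacent_lex B [] xs"
    using ex_adjacent_lex[OF assms(3,1)] by blast
  have "length xs = 10"
    using xs(1,2) assms(4) distinct_card by fastforce
  then obtain a0 a1 a2 a3 a4 a5 a6 a7 a8 a9 where eq: "xs = [a0, a1, a2, a3, a4, a5, a6, a7, a8, a9]"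
    by (rule length_10E)
  note flip = flipsI[OF assms(1), of xs, unfolded eq, simplified]
  have "clauses B 4 4 xs"
    using clausesI[OF assms(2)] xs by simp
  then have "edge_list B [a0, a1, a2, a3, a4, a5, a6, a7, a8, a9] \<in> set (map bits [''000001111011100111111100010101110100000110011'',
      ''000011111011000111111100100101010101100010011'',
      ''000011111011001111111000101001100101010001110'',
      ''000011111011001111111001001011101011100010100'',
      ''000011111011001111111001001011101100011110010'',
      ''000011111011001111111001001011101101100010010'',
      ''000011111011001111111001001011111000011110010'',
      ''000011111011001111111001001011111000101010100'',
      ''000011111011001111111001001011111100011100010'',
      ''000011111011001111111001001011111100011110010'',
      ''000011111011001111111001001110100110110011010'',
      ''000011111011001111111001001110100111010100010'',
      ''000011111011001111111001101010101000101011100'',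
      ''000011111011001111111001101010101000101110001'',
      ''000011111011001111111001101010101000110011010'',
      ''000011111011001111111001101010101001100010011'',
      ''000011111011001111111011001101101100101110000'',
      ''000011111011001111111011001101101100101110001'',
      ''000011111011011111110011010101110101100001100'',
      ''000011111011011111110011010101110101100001101'',
      ''000111111010011111110011111100001011010001100'',
      ''000111111010011111110011111100001011010001101'',
      ''000111111110011111110011111100001011010001100''])"
    using lex_labelling_4_4[OF assms(1)] xs(3) unfolding eq by blast
  moreover have relabel: thesis if "edge_list B hs = r"
    "r \<in> {critical_a, critical_b, critical_c, critical_d, critical_e}" "set hs = set xs"
    "distinct hs" for hs r
    using that xs(1) by (intro thesisI[of hs]) auto
  ultimately show thesis
    unfolding list.map list.set insert_iff empty_iff
  proof (elim disjE)
    assume "edge_list B [a0, a1, a2, a3, a4, a5, a6, a7, a8, a9] = bits ''000001111011100111111100010101110100000110011''"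
    then show thesis
      using xs(2) by (intro relabel[of "[a0, a1, a2, a3, a4, a5, a6, a7, a8, a9]" critical_a]) (auto simp: eq flip code_defs)
  next
    assume "edge_list B [a0, a1, a2, a3, a4, a5, a6, a7, a8, a9] = bits ''000011111011000111111100100101010101100010011''"
    then show thesis
      using xs(2) by (intro relabel[of "[a1, a0, a2, a6, a7, a5, a3, a4, a9, a8]" critical_a]) (auto simp: eq flip code_defs)
  next
    assume "edge_list B [a0, a1, a2, a3, a4, a5, a6, a7, a8, a9] = bits ''000011111011001111111000101001100101010001110''"
    then show thesis
      using xs(2) by (intro relabel[of "[a2, a0, a1, a8, a9, a7, a3, a4, a6, a5]" critical_a]) (auto simp: eq flip code_defs)
  next
    assume "edge_list B [a0, a1, a2, a3, a4, a5, a6, a7, a8, a9] = bits ''000011111011001111111001001011101011100010100''"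
    then show thesis
      using xs(2) by (intro relabel[of "[a0, a1, a2, a3, a4, a5, a6, a7, a8, a9]" critical_b]) (auto simp: eq flip code_defs)
  next
    assume "edge_list B [a0, a1, a2, a3, a4, a5, a6, a7, a8, a9] = bits ''000011111011001111111001001011101100011110010''"
    then show thesis
      using xs(2) by (intro relabel[of "[a0, a1, a2, a3, a4, a5, a6, a7, a8, a9]" critical_c]) (auto simp: eq flip code_defs)
  next
    assume "edge_list B [a0, a1, a2, a3, a4, a5, a6, a7, a8, a9] = bits ''000011111011001111111001001011101101100010010''"
    then show thesis
      using xs(2) by (intro relabel[of "[a0, a1, a2, a3, a4, a5, a6, a7, a8, a9]" critical_d]) (auto simp: eq flip code_defs)
  next
    assume "edge_list B [a0, a1, a2, a3, a4, a5, a6, a7, a8, a9] = bits ''000011111011001111111001001011111000011110010''"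
    then show thesis
      using xs(2) by (intro relabel[of "[a0, a2, a1, a3, a4, a7, a8, a5, a6, a9]" critical_c]) (auto simp: eq flip code_defs)
  next
    assume "edge_list B [a0, a1, a2, a3, a4, a5, a6, a7, a8, a9] = bits ''000011111011001111111001001011111000101010100''"
    then show thesis
      using xs(2) by (intro relabel[of "[a0, a2, a1, a3, a4, a7, a8, a5, a6, a9]" critical_d]) (auto simp: eq flip code_defs)
  next
    assume "edge_list B [a0, a1, a2, a3, a4, a5, a6, a7, a8, a9] = bits ''000011111011001111111001001011111100011100010''"
    then show thesis
      using xs(2) by (intro relabel[of "[a1, a2, a0, a5, a6, a7, a8, a3, a4, a9]" critical_c]) (auto simp: eq flip code_defs)
  next
    assume "edge_list B [a0, a1, a2, a3, a4, a5, a6, a7, a8, a9] = bits ''000011111011001111111001001011111100011110010''"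
    then show thesis
      using xs(2) by (intro relabel[of "[a0, a1, a2, a3, a4, a5, a6, a7, a8, a9]" critical_e]) (auto simp: eq flip code_defs)
  next
    assume "edge_list B [a0, a1, a2, a3, a4, a5, a6, a7, a8, a9] = bits ''000011111011001111111001001110100110110011010''"
    then show thesis
      using xs(2) by (intro relabel[of "[a0, a1, a2, a4, a3, a6, a5, a7, a8, a9]" critical_c]) (auto simp: eq flip code_defs)
  next
    assume "edge_list B [a0, a1, a2, a3, a4, a5, a6, a7, a8, a9] = bits ''000011111011001111111001001110100111010100010''"
    then show thesis
      using xs(2) by (intro relabel[of "[a0, a1, a2, a4, a3, a6, a5, a7, a8, a9]" critical_d]) (auto simp: eq flip code_defs)
  next
    assume "edge_list B [a0, a1, a2, a3, a4, a5, a6, a7, a8, a9] = bits ''000011111011001111111001101010101000101011100''"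
    then show thesis
      using xs(2) by (intro relabel[of "[a1, a0, a2, a5, a6, a3, a4, a8, a7, a9]" critical_b]) (auto simp: eq flip code_defs)
  next
    assume "edge_list B [a0, a1, a2, a3, a4, a5, a6, a7, a8, a9] = bits ''000011111011001111111001101010101000101110001''"
    then show thesis
      using xs(2) by (intro relabel[of "[a1, a0, a2, a5, a6, a3, a4, a8, a7, a9]" critical_d]) (auto simp: eq flip code_defs)
  next
    assume "edge_list B [a0, a1, a2, a3, a4, a5, a6, a7, a8, a9] = bits ''000011111011001111111001101010101000110011010''"
    then show thesis
      using xs(2) by (intro relabel[of "[a1, a0, a2, a6, a5, a4, a3, a7, a8, a9]" critical_d]) (auto simp: eq flip code_defs)
  next
    assume "edge_list B [a0, a1, a2, a3, a4, a5, a6, a7, a8, a9] = bits ''000011111011001111111001101010101001100010011''"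
    then show thesis
      using xs(2) by (intro relabel[of "[a2, a0, a1, a7, a8, a3, a4, a6, a5, a9]" critical_b]) (auto simp: eq flip code_defs)
  next
    assume "edge_list B [a0, a1, a2, a3, a4, a5, a6, a7, a8, a9] = bits ''000011111011001111111011001101101100101110000''"
    then show thesis
      using xs(2) by (intro relabel[of "[a3, a4, a0, a5, a8, a6, a9, a1, a2, a7]" critical_c]) (auto simp: eq flip code_defs)
  next
    assume "edge_list B [a0, a1, a2, a3, a4, a5, a6, a7, a8, a9] = bits ''000011111011001111111011001101101100101110001''"
    then show thesis
      using xs(2) by (intro relabel[of "[a0, a3, a4, a1, a2, a5, a8, a6, a9, a7]" critical_e]) (auto simp: eq flip code_defs)
  next
    assume "edge_list B [a0, a1, a2, a3, a4, a5, a6, a7, a8, a9] = bits ''000011111011011111110011010101110101100001100''"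
    then show thesis
      using xs(2) by (intro relabel[of "[a3, a4, a0, a6, a8, a7, a9, a2, a1, a5]" critical_c]) (auto simp: eq flip code_defs)
  next
    assume "edge_list B [a0, a1, a2, a3, a4, a5, a6, a7, a8, a9] = bits ''000011111011011111110011010101110101100001101''"
    then show thesis
      using xs(2) by (intro relabel[of "[a0, a3, a4, a2, a1, a6, a8, a7, a9, a5]" critical_e]) (auto simp: eq flip code_defs)
  next
    assume "edge_list B [a0, a1, a2, a3, a4, a5, a6, a7, a8, a9] = bits ''000111111010011111110011111100001011010001100''"
    then show thesis
      using xs(2) by (intro relabel[of "[a4, a5, a1, a6, a8, a7, a9, a2, a0, a3]" critical_c]) (auto simp: eq flip code_defs)
  next
    assume "edge_list B [a0, a1, a2, a3, a4, a5, a6, a7, a8, a9] = bits ''000111111010011111110011111100001011010001101''"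
    then show thesis
      using xs(2) by (intro relabel[of "[a1, a4, a5, a2, a0, a6, a8, a7, a9, a3]" critical_e]) (auto simp: eq flip code_defs)
  next
    assume "edge_list B [a0, a1, a2, a3, a4, a5, a6, a7, a8, a9] = bits ''000111111110011111110011111100001011010001100''"
    then show thesis
      using xs(2) by (intro relabel[of "[a4, a6, a8, a5, a1, a7, a2, a9, a3, a0]" critical_e]) (auto simp: eq flip code_defs)
  qed (rule FalseE)
qed

lemma avoids_subset: "avoids B k l V \<Longrightarrow> W \<subseteq> V \<Longrightarrow> avoids B k l W"
  unfolding avoids_def by blast

text \<open>Ten of eleven vertices would form the Petersen graph or the blow-up, and neither extends
  by a vertex. This is \<open>r(K_3, K_5 - e) \<le> 11\<close>.\<close>

lemma card_avoids_3_5_le: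
  assumes "symp B" "avoids B 3 5 W" "finite W"
  shows "card W \<le> 10"
proof (rule ccontr)
  assume "\<not> ?thesis"
  then have "11 \<le> card W"
    by simp
  then obtain U where U: "U \<subseteq> W" "card U = 11" "finite U"
    using obtain_subset_with_card_n by blast
  then obtain x where x: "x \<in> U"
    by (metis card.empty ex_in_conv zero_neq_numeral)
  have "avoids B 3 5 (U - {x})"
    using assms(2) U(1) by (auto intro: avoids_subset)
  moreover have "card (U - {x}) = 10" "finite (U - {x})"
    using U x by auto
  ultimately obtain hs where hs: "set hs = U - {x}" "distinct hs"
    and m: "edge_list B hs \<in> {petersen, c5_blowup}"
    using labelling_3_5[OF assms(1)] by blast
  have "length hs = 10"
    using hs \<open>card (U - {x}) = 10\<close> distinct_card by fastforce
  then obtain a0 a1 a2 a3 a4 a5 a6 a7 a8 a9 where eq: "hs = [a0, a1, a2, a3, a4, a5, a6, a7, a8, a9]"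
    by (rule length_10E)
  have "ext_clauses B 2 4 hs x"
    using assms(2) hs U(1) x by (intro ext_clausesI[of _ _ _ W]) (auto simp: numeral_eq_Suc)
  with m show False
    unfolding eq by (elim insertE emptyE) (erule (1) petersen_maximal, erule (1) c5_blowup_maximal)
qed

text \<open>As before, with the five critical graphs:
  \<open>r(K_4, K_4 - e) \<le> 11\<close>.\<close>

lemma card_avoids_4_4_le:
  assumes "symp B" "avoids B 4 4 W" "finite W"
  shows "card W \<le> 10"
proof (rule ccontr)
  assume "\<not> ?thesis"
  then have "11 \<le> card W"
    by simp
  then obtain U where U: "U \<subseteq> W" "card U = 11" "finite U"
    using obtain_subset_with_card_n by blast
  then obtain x where x: "x \<in> U"
    by (metis card.empty ex_in_conv zero_neq_numeral)
  have "avoids B 4 4 (U - {x})"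
    using assms(2) U(1) by (auto intro: avoids_subset)
  moreover have "card (U - {x}) = 10" "finite (U - {x})"
    using U x by auto
  ultimately obtain hs where hs: "set hs = U - {x}" "distinct hs"
    and m: "edge_list B hs \<in> {critical_a, critical_b, critical_c, critical_d, critical_e}"
    using labelling_4_4[OF assms(1)] by blast
  have "length hs = 10"
    using hs \<open>card (U - {x}) = 10\<close> distinct_card by fastforce
  then obtain a0 a1 a2 a3 a4 a5 a6 a7 a8 a9 where eq: "hs = [a0, a1, a2, a3, a4, a5, a6, a7, a8, a9]"
    by (rule length_10E)
  have "ext_clauses B 3 3 hs x"
    using assms(2) hs U(1) x by (intro ext_clausesI[of _ _ _ W]) (auto simp: numeral_eq_Suc)
  with m show False
    unfolding eq by (elim insertE emptyE) (erule (1) critical_a_maximal, erule (1) critical_b_maximal,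
      erule (1) critical_c_maximal, erule (1) critical_d_maximal, erule (1) critical_e_maximal)
qed

lemma no_degree_8:
  assumes "symp B" "avoids B 4 5 V" "finite V" "v \<in> V" "card (nbhd B V v) = 8"
    "card (conbhd B V v) = 10"
  shows False
proof -
  have fin: "finite (nbhd B V v)" "finite (conbhd B V v)"
    using assms(3) by (simp_all add: nbhd_def conbhd_def)
  have N: "avoids B 3 5 (nbhd B V v)"
    using assms(2,4) by (intro avoids_nbhd) (auto simp: numeral_eq_Suc)
  have "avoids B 4 4 (conbhd B V v)"
    using assms(2,4) by (intro avoids_conbhd) (auto simp: numeral_eq_Suc)
  then obtain hs where hs: "set hs = conbhd B V v" "distinct hs"
    and m: "edge_list B hs \<in> {critical_a, critical_b, critical_c, critical_d, critical_e}"
    using labelling_4_4[OF assms(1) _ fin(2) assms(6)] by blast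
  obtain xs where xs: "set xs = nbhd B V v" "distinct xs" and sorted: "lex_sorted B hs xs"
    using ex_lex_sorted[OF fin(1)] by blast
  have "length hs = 10" "length xs = 8"
    using hs xs assms(5,6) distinct_card by fastforce+
  obtain a0 a1 a2 a3 a4 a5 a6 a7 a8 a9 where eq: "hs = [a0, a1, a2, a3, a4, a5, a6, a7, a8, a9]"
    using \<open>length hs = 10\<close> by (rule length_10E)
  obtain x0 x1 x2 x3 x4 x5 x6 x7 where x_eq: "xs = [x0, x1, x2, x3, x4, x5, x6, x7]"
    using \<open>length xs = 8\<close> by (rule length_8E)
  have sub: "set hs \<subseteq> V" "set xs \<subseteq> V" "v \<notin> set hs" "v \<notin> set xs" "set hs \<inter> set xs = {}"
    by (auto simp: hs xs nbhd_def conbhd_def)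
  have cone: "list_all (cone_clauses B hs) xs"
    unfolding list_all_iff
  proof
    fix x assume "x \<in> set xs"
    then show "cone_clauses B hs x"
      using sub hs assms(4) by (intro cone_clausesI[OF assms(2), of v]) (auto simp: conbhd_def)
  qed
  have pairs: "all_pairs (pair_clauses B hs) xs"
    using sub hs(2) by (intro all_pairsI[OF xs(2)] pair_clausesI[OF assms(2)]) auto
  have tri: "list_all (\<lambda>ts. some_true (map Not (edge_list B ts))) (choose_list 3 xs)"
    using clausesI[OF N, of xs] xs by (simp add: clauses_def)
  have red: "list_all (\<lambda>ts. two_clauses (edge_list B ts) (concat (map (\<lambda>x. [B x a, B x b]) ts)))
      (choose_list 3 xs)" if "a \<in> set hs" "b \<in> set hs" "a \<noteq> b" "\<not> B a b" for a b
    using that sub xs(2) by (intro red_pair_clauses[OF assms(2)]) auto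
  from m show False
  proof (elim insertE emptyE)
    assume m: "edge_list B hs = critical_a"
    \<comment> \<open>Two red pairs of this graph whose clauses with triples of blue neighbours
      enter the refutation.\<close>
    have "\<not> B a2 a9" "\<not> B a4 a9"
      using m by (simp_all add: eq code_defs)
    then have "list_all (\<lambda>ts. two_clauses (edge_list B ts) (concat (map (\<lambda>x. [B x a2, B x a9]) ts))) (choose_list 3 xs)"
      "list_all (\<lambda>ts. two_clauses (edge_list B ts) (concat (map (\<lambda>x. [B x a4, B x a9]) ts))) (choose_list 3 xs)"
      using hs(2) unfolding eq by (auto intro!: red simp: eq)
    with m cone pairs sorted tri show False
      unfolding eq x_eq by (intro critical_a_no_gluing)
  next
    assume m: "edge_list B hs = critical_b"
    have "\<not> B a2 a8" "\<not> B a4 a8"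
      using m by (simp_all add: eq code_defs)
    then have "list_all (\<lambda>ts. two_clauses (edge_list B ts) (concat (map (\<lambda>x. [B x a2, B x a8]) ts))) (choose_list 3 xs)"
      "list_all (\<lambda>ts. two_clauses (edge_list B ts) (concat (map (\<lambda>x. [B x a4, B x a8]) ts))) (choose_list 3 xs)"
      using hs(2) unfolding eq by (auto intro!: red simp: eq)
    with m cone pairs sorted tri show False
      unfolding eq x_eq by (intro critical_b_no_gluing)
  next
    assume m: "edge_list B hs = critical_c"
    from this cone pairs sorted tri show False
      unfolding eq x_eq by (rule critical_c_no_gluing)
  next
    assume m: "edge_list B hs = critical_d"
    from this cone pairs sorted tri show False
      unfolding eq x_eq by (rule critical_d_no_gluing)
  next
    assume m: "edge_list B hs = critical_e"
    from this cone pairs sorted tri show False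
      unfolding eq x_eq by (rule critical_e_no_gluing)
  qed
qed

text \<open>Conditions on red neighbours of \<open>v\<close>, stated for an arbitrary labelling
  \<open>hs\<close> of the blue neighbourhood because \<open>no_degree_10\<close> relabels
  it.\<close>

lemma far_clauses:
  assumes "avoids B 4 5 V" "v \<in> V" "set hs = nbhd B V v" "distinct hs" "set xs \<subseteq> conbhd B V v"
    "distinct xs"
  shows "list_all (ext_clauses B 3 4 hs) xs" "all_pairs (pair_clauses B hs) xs"
    "list_all (triple_clauses B hs) (choose_list 3 xs)"
proof -
  have sub: "set hs \<subseteq> V" "set xs \<subseteq> V" "v \<notin> set hs" "v \<notin> set xs" "set hs \<inter> set xs = {}"
    using assms(3,5) by (auto simp: nbhd_def conbhd_def)
  show "list_all (ext_clauses B 3 4 hs) xs"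
    unfolding list_all_iff
  proof
    fix x assume "x \<in> set xs"
    then show "ext_clauses B 3 4 hs x"
      using sub assms(1,4) by (intro ext_clausesI[of _ _ _ V]) (auto simp: numeral_eq_Suc)
  qed
  show "all_pairs (pair_clauses B hs) xs"
    using sub assms(4) by (intro all_pairsI[OF assms(6)] pair_clausesI[OF assms(1)]) auto
  show "list_all (triple_clauses B hs) (choose_list 3 xs)"
    unfolding list_all_iff
  proof
    fix ts assume ts: "ts \<in> set (choose_list 3 xs)"
    then obtain x y z where xyz: "ts = [x, y, z]"
      using choose_listD[OF ts] by (auto simp: numeral_eq_Suc length_Suc_conv)
    have "distinct [x, y, z]" "set [x, y, z] \<subseteq> set xs"
      using choose_listD[OF ts] assms(6) xyz by auto
    then show "triple_clauses B hs ts"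
      unfolding xyz using sub assms(2-5)
      by (intro triple_clausesI[OF assms(1), of v]) (auto simp: nbhd_def conbhd_def)
  qed
qed

lemma ex_blue_triangle:
  assumes "avoids B 4 4 W" "card W \<ge> 7"
  obtains x y z where "distinct [x, y, z]" "set [x, y, z] \<subseteq> W" "B x y" "B x z" "B y z"
proof -
  obtain U where U: "U \<subseteq> W" "card U = 7" "finite U"
    using assms(2) obtain_subset_with_card_n by blast
  obtain xs where xs: "set xs = U" "distinct xs"
    using finite_distinct_list[OF U(3)] by blast
  then have "length xs = 7"
    using U(2) distinct_card by fastforce
  then obtain x0 x1 x2 x3 x4 x5 x6 where eq: "xs = [x0, x1, x2, x3, x4, x5, x6]"
    by (rule length_7E)
  have "clauses B 4 4 xs"
    using clausesI[OF assms(1)] xs U(1) by simp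
  then have "\<not> list_all (\<lambda>ts. some_true (map Not (edge_list B ts))) (choose_list 3 xs)"
    unfolding eq by (intro notI) (rule blue_triangle_7)
  then obtain ts where ts: "ts \<in> set (choose_list 3 xs)" "\<not> some_true (map Not (edge_list B ts))"
    unfolding list_all_iff by blast
  then obtain x y z where xyz: "ts = [x, y, z]"
    using choose_listD[OF ts(1)] by (auto simp: numeral_eq_Suc length_Suc_conv)
  show thesis
    using ts choose_listD[OF ts(1)] xs U(1) xyz by (intro that[of x y z]) auto
qed

lemma ex_blue_star:
  assumes "symp B" "avoids B 4 4 W" "finite W" "card W = 8"
  obtains x ts where "distinct (x # ts)" "set (x # ts) \<subseteq> W" "length ts = 4" "list_all (B x) ts"
proof -
  obtain xs where xs: "set xs = W" "distinct xs" "adjacent_lex B [] xs"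
    using ex_adjacent_lex[OF assms(3,1)] by blast
  then have "length xs = 8"
    using assms(4) distinct_card by fastforce
  then obtain x0 x1 x2 x3 x4 x5 x6 x7 where eq: "xs = [x0, x1, x2, x3, x4, x5, x6, x7]"
    by (rule length_8E)
  have "clauses B 4 4 xs"
    using clausesI[OF assms(2)] xs by simp
  then have "\<not> no_star B 4 [] xs"
    using xs(3) unfolding eq by (intro notI) (rule blue_star_8[OF assms(1)])
  then show thesis
    using no_starI[of "[]" xs 4 B] xs that by auto
qed

lemma no_degree_10:
  assumes "symp B" "avoids B 4 5 V" "finite V" "v \<in> V" "card (nbhd B V v) = 10"
    "card (conbhd B V v) = 8"
  shows False
proof -
  have fin: "finite (nbhd B V v)" "finite (conbhd B V v)"
    using assms(3) by (simp_all add: nbhd_def conbhd_def)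
  have O: "avoids B 4 4 (conbhd B V v)"
    using assms(2,4) by (intro avoids_conbhd) (auto simp: numeral_eq_Suc)
  have "avoids B 3 5 (nbhd B V v)"
    using assms(2,4) by (intro avoids_nbhd) (auto simp: numeral_eq_Suc)
  then obtain hs where hs: "set hs = nbhd B V v" "distinct hs"
    and m: "edge_list B hs \<in> {petersen, c5_blowup}"
    using labelling_3_5[OF assms(1) _ fin(1) assms(5)] by blast
  have "length hs = 10"
    using hs assms(5) distinct_card by fastforce
  then obtain a0 a1 a2 a3 a4 a5 a6 a7 a8 a9 where eq: "hs = [a0, a1, a2, a3, a4, a5, a6, a7, a8, a9]"
    by (rule length_10E)
  note far = far_clauses[OF assms(2,4)]
  from m show False
  proof (elim insertE emptyE)
    assume m: "edge_list B hs = petersen"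
    obtain x y z where xyz: "distinct [x, y, z]" "set [x, y, z] \<subseteq> conbhd B V v" "B x y" "B x z"
    "B y z"
      using ex_blue_triangle[OF O] assms(6) by auto
    have "triple_clauses B hs [x, y, z]"
      using far(3)[OF hs xyz(2,1)] by (simp add: numeral_eq_Suc)
    with m far(1,2)[OF hs xyz(2,1)] xyz(3-) show False
      unfolding eq by (intro petersen_no_blue_triangle)
  next
    assume m: "edge_list B hs = c5_blowup"
    obtain x0 ts where star: "distinct (x0 # ts)" "set (x0 # ts) \<subseteq> conbhd B V v" "length ts = 4"
      "list_all (B x0) ts"
      using ex_blue_star[OF assms(1) O fin(2) assms(6)] by blast
    \<comment> \<open>For arbitrary \<open>gs\<close>, since the leaves are sorted anew after twins
      have been exchanged.\<close>
    have leaves: "\<exists>x1 x2 x3 x4. set [x1, x2, x3, x4] = set ts \<and> distinct [x1, x2, x3, x4] \<and>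
        lex_sorted B gs [x1, x2, x3, x4] \<and> list_all (B x0) [x1, x2, x3, x4]" for gs
    proof -
      obtain us where us: "set us = set ts" "distinct us" "lex_sorted B gs us"
        using ex_lex_sorted[of "set ts"] by blast
      have "length us = 4"
        using us star(1,3) by (metis distinct.simps(2) distinct_card)
      then obtain x1 x2 x3 x4 where "us = [x1, x2, x3, x4]"
        by (auto simp: numeral_eq_Suc length_Suc_conv)
      moreover have "list_all (B x0) us"
        using us(1) star(4) by (simp add: list_all_iff)
      ultimately show ?thesis
        using us by blast
    qed
    have trans: "B x0 a0 \<noteq> B x0 a1 \<and> B x0 a2 \<noteq> B x0 a3 \<and>
      B x0 a4 \<noteq> B x0 a5 \<and> B x0 a6 \<noteq> B x0 a7 \<and> B x0 a8 \<noteq> B x0 a9"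
    proof -
      obtain x1 x2 x3 x4 where x: "set [x1, x2, x3, x4] = set ts" "distinct [x1, x2, x3, x4]"
        "lex_sorted B hs [x1, x2, x3, x4]" "list_all (B x0) [x1, x2, x3, x4]"
        using leaves by blast
      have "set [x0, x1, x2, x3, x4] \<subseteq> conbhd B V v" "distinct [x0, x1, x2, x3, x4]"
        using x(1,2) star(1,2) by auto
      note f = far[OF hs this]
      show ?thesis
        using m f x(3,4) unfolding eq by (rule c5_blowup_star_transversal)
    qed
    \<comment> \<open>Swapping two vertices of the blow-up with the same neighbours is an automorphism.\<close>
    obtain p0 q0 where pq0: "p0 = a0 \<and> q0 = a1 \<or> p0 = a1 \<and> q0 = a0" "B x0 p0" "\<not> B x0 q0"
      using trans by metis
    obtain p1 q1 where pq1: "p1 = a2 \<and> q1 = a3 \<or> p1 = a3 \<and> q1 = a2" "B x0 p1" "\<not> B x0 q1"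
      using trans by metis
    obtain p2 q2 where pq2: "p2 = a4 \<and> q2 = a5 \<or> p2 = a5 \<and> q2 = a4" "B x0 p2" "\<not> B x0 q2"
      using trans by metis
    obtain p3 q3 where pq3: "p3 = a6 \<and> q3 = a7 \<or> p3 = a7 \<and> q3 = a6" "B x0 p3" "\<not> B x0 q3"
      using trans by metis
    obtain p4 q4 where pq4: "p4 = a8 \<and> q4 = a9 \<or> p4 = a9 \<and> q4 = a8" "B x0 p4" "\<not> B x0 q4"
      using trans by metis
    let ?gs = "[p0, q0, p1, q1, p2, q2, p3, q3, p4, q4]"
    have "{p0, q0} = {a0, a1}" "{p1, q1} = {a2, a3}" "{p2, q2} = {a4, a5}" "{p3, q3} = {a6, a7}"
      "{p4, q4} = {a8, a9}"
      using pq0(1) pq1(1) pq2(1) pq3(1) pq4(1) by blast+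
    then have "{p0, q0} \<union> {p1, q1} \<union> {p2, q2} \<union> {p3, q3} \<union> {p4, q4} = set hs"
      by (simp add: eq insert_commute)
    then have set_gs: "set ?gs = nbhd B V v"
      unfolding hs(1)[symmetric] by (simp only: list.set Un_insert_left Un_empty_left)
    have "card (set ?gs) = length ?gs"
      unfolding set_gs assms(5) by simp
    then have gs_distinct: "distinct ?gs"
      by (rule card_distinct)
    note flip = flipsI[OF assms(1), of hs, unfolded eq, simplified]
    note m' = m[unfolded eq code_defs, simplified]
    \<comment> \<open>All 32 orders within the twin pairs give the same code.\<close>
    have gs: "edge_list B ?gs = c5_blowup"
      using pq0(1) pq1(1) pq2(1) pq3(1) pq4(1)
      by (elim disjE conjE) (simp_all add: code_defs flip m')
    obtain x1 x2 x3 x4 where x: "set [x1, x2, x3, x4] = set ts" "distinct [x1, x2, x3, x4]"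
      "lex_sorted B ?gs [x1, x2, x3, x4]" "list_all (B x0) [x1, x2, x3, x4]"
      using leaves by blast
    \<comment> \<open>The three red neighbours besides the centre and its leaves.\<close>
    obtain ws where ws: "set ws = conbhd B V v - set (x0 # ts)" "distinct ws" "lex_sorted B ?gs ws"
      using ex_lex_sorted[of "conbhd B V v - set (x0 # ts)"] fin(2) by blast
    have "card (set (x0 # ts)) = 5"
      using star(1,3) distinct_card[OF star(1)] by simp
    then have "card (set ws) = 3"
      unfolding ws(1) by (subst card_Diff_subset[OF _ star(2)]) (simp_all add: assms(6))
    then have "length ws = 3"
      using distinct_card[OF ws(2)] by simp
    then obtain x5 x6 x7 where ws_eq: "ws = [x5, x6, x7]"
      by (auto simp: numeral_eq_Suc length_Suc_conv)
    have xs: "set [x0, x1, x2, x3, x4, x5, x6] \<subseteq> conbhd B V v"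
    "distinct [x0, x1, x2, x3, x4, x5, x6]"
      using x(1,2) star(1,2) ws(1,2) unfolding ws_eq by auto
    have "lex_sorted B ?gs [x5, x6]"
      using ws(3) unfolding ws_eq by simp
    moreover have "clauses B 4 4 [x0, x1, x2, x3, x4, x5, x6]"
      using clausesI[OF O xs] .
    ultimately show False
      using far[OF set_gs gs_distinct xs] x(3,4) pq0(2,3) pq1(2,3) pq2(2,3) pq3(2,3) pq4(2,3)
      by (intro c5_blowup_no_star[OF gs])
  qed
qed

text \<open>Handshake argument: exchanging the entries maps the increasing pairs onto the decreasing
  ones.\<close>

lemma even_card_symmetric:
  fixes V :: "'a :: linorder set"
  assumes "symp B" "finite V"
  shows "even (card {(u, w). u \<in> V \<and> w \<in> V \<and> w \<noteq> u \<and> B u w})"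
proof -
  let ?E = "{(u, w). u \<in> V \<and> w \<in> V \<and> w \<noteq> u \<and> B u w}"
  let ?L = "{(u, w). u \<in> V \<and> w \<in> V \<and> u < w \<and> B u w}"
  have "finite ?L"
    by (rule finite_subset[of _ "V \<times> V"]) (use assms(2) in auto)
  moreover have "?E = ?L \<union> prod.swap ` ?L"
    using assms(1) by (auto simp: image_iff neq_iff dest: sympD)
  moreover have "?L \<inter> prod.swap ` ?L = {}"
    by auto
  ultimately have "card ?E = card ?L + card (prod.swap ` ?L)"
    by (simp add: card_Un_disjoint)
  also have "card (prod.swap ` ?L) = card ?L"
    by (rule card_image) simp
  finally show ?thesis by simp
qed

theorem avoids_4_5_card:
  fixes V :: "'a :: linorder set"
  assumes "symp B" "avoids B 4 5 V" "finite V"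
  shows "card V \<noteq> 19"
proof
  assume card: "card V = 19"
  have deg: "card (nbhd B V v) = 9" if v: "v \<in> V" for v
  proof -
    have sum: "card (nbhd B V v) + card (conbhd B V v) = 18"
      using card_nbhd_conbhd[OF assms(3) v] card by simp
    have "card (nbhd B V v) \<le> 10"
      using assms(2,3) v by (intro card_avoids_3_5_le[OF assms(1)] avoids_nbhd)
        (auto simp: numeral_eq_Suc nbhd_def)
    moreover have "card (conbhd B V v) \<le> 10"
      using assms(2,3) v by (intro card_avoids_4_4_le[OF assms(1)] avoids_conbhd)
        (auto simp: numeral_eq_Suc conbhd_def)
    moreover have "card (nbhd B V v) \<noteq> 8"
      using no_degree_8[OF assms(1-3) v] sum by auto
    moreover have "card (nbhd B V v) \<noteq> 10"
      using no_degree_10[OF assms(1-3) v] sum by auto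
    \<comment> \<open>Two degrees of at most 10 with sum 18 leave 8, 9 and 10.\<close>
    ultimately show ?thesis
      using sum by linarith
  qed
  have "{(u, w). u \<in> V \<and> w \<in> V \<and> w \<noteq> u \<and> B u w} = (SIGMA u:V. nbhd B V u)"
    by (auto simp: nbhd_def)
  \<comment> \<open>\<open>171 = 19 * 9\<close> is odd.\<close>
  moreover have "card (SIGMA u:V. nbhd B V u) = 171"
    using card_SigmaI[of V "nbhd B V"] assms(3) deg card by (simp add: nbhd_def)
  ultimately show False
    using even_card_symmetric[OF assms(1,3)] by simp
qed

section \<open>Monochromatic copies\<close>

text \<open>An embedding of a graph on \<open>{..<m}\<close> is the list of its values. Taking each
  edge once, as \<open>{j, i}\<close> with \<open>j < i\<close>, lets the condition unfold for
  concrete \<open>m\<close>.\<close>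

lemma contains_monochromatic_copy_iff:
  assumes "E \<subseteq> [{..<m}]\<^bsup>2\<^esup>"
  shows "contains_copy (colour_class (complete_graph n) c k) ({..<m}, E) \<longleftrightarrow>
    (\<exists>xs. length xs = m \<and> distinct xs \<and> set xs \<subseteq> {..<n} \<and>
      (\<forall>i<m. \<forall>j<i. {j, i} \<in> E \<longrightarrow> c {xs ! j, xs ! i} = k))"
    (is "?copy \<longleftrightarrow> (\<exists>xs. ?P xs)")
proof
  assume ?copy
  then obtain f where f: "inj_on f {..<m}" "f ` {..<m} \<subseteq> {..<n}" "\<forall>e\<in>E. c (f ` e) = k"
    by (auto simp: contains_copy_def colour_class_def complete_graph_def)
  have "c {f i, f j} = k" if "{i, j} \<in> E" for i j
    using f(3) that by force
  then have "?P (map f [0..<m])"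
    using f(1,2) by (auto simp: distinct_map atLeast0LessThan)
  then show "\<exists>xs. ?P xs" ..
next
  assume "\<exists>xs. ?P xs"
  then obtain xs where xs: "length xs = m" "distinct xs" "set xs \<subseteq> {..<n}"
    and col: "\<And>i j. i < m \<Longrightarrow> j < i \<Longrightarrow> {j, i} \<in> E \<Longrightarrow> c {xs ! j, xs ! i} = k"
    by blast
  have inj: "inj_on ((!) xs) {..<m}"
    using xs(1,2) by (simp add: inj_on_nth)
  have "(!) xs ` e \<in> [{..<n}]\<^bsup>2\<^esup> \<and> c ((!) xs ` e) = k" if "e \<in> E" for e
  proof
    have e: "e \<subseteq> {..<m}" "finite e" "card e = 2"
      using that assms by (auto simp: nsets_def)
    then have "inj_on ((!) xs) e"
      using inj inj_on_subset by blast
    then show "(!) xs ` e \<in> [{..<n}]\<^bsup>2\<^esup>"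
      using e xs(1,3) by (auto simp: nsets_def card_image subset_iff)
    obtain i j where "e = {j, i}" "j < i"
      using e(3) unfolding card_2_iff by (metis insert_commute linorder_neqE_nat)
    then show "c ((!) xs ` e) = k"
      using col[of i j] that e(1) by simp
  qed
  moreover have "(!) xs ` {..<m} \<subseteq> {..<n}"
    using xs(1,3) nth_mem by fastforce
  ultimately show ?copy
    using inj
    by (auto simp: contains_copy_def colour_class_def complete_graph_def intro!: exI[of _ "(!) xs"])
qed

lemma ex_list_5: "(\<exists>xs. length xs = 5 \<and> P xs) \<longleftrightarrow> (\<exists>a b x y z. P [a, b, x, y, z])"
proof
  assume "\<exists>xs. length xs = 5 \<and> P xs"
  then obtain xs where "length xs = 5" "P xs"
    by blast
  moreover from \<open>length xs = 5\<close> obtain a b x y z where "xs = [a, b, x, y, z]"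
    by (auto simp: numeral_eq_Suc length_Suc_conv)
  ultimately show "\<exists>a b x y z. P [a, b, x, y, z]"
    by blast
next
  assume "\<exists>a b x y z. P [a, b, x, y, z]"
  then obtain a b x y z where "P [a, b, x, y, z]"
    by blast
  then show "\<exists>xs. length xs = 5 \<and> P xs"
    by (intro exI[of _ "[a, b, x, y, z]"]) simp
qed

text \<open>\<open>a\<close> and \<open>b\<close> are the images of the ends 0 and 1 of the deleted
  edge.\<close>

lemma copy_complete_minus_edge_iff:
  "contains_copy (colour_class (complete_graph n) c k) (complete_minus_edge 5) \<longleftrightarrow>
    (\<exists>a b x y z. distinct [a, b, x, y, z] \<and> set [a, b, x, y, z] \<subseteq> {..<n} \<and>
      c {a, x} = k \<and> c {a, y} = k \<and> c {a, z} = k \<and> c {b, x} = k \<and> c {b, y} = k \<and> c {b, z} = k \<and>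
      c {x, y} = k \<and> c {x, z} = k \<and> c {y, z} = k)"
proof -
  have eq: "complete_minus_edge 5 = ({..<5}, [{..<5}]\<^bsup>2\<^esup> - {{0, 1}})"
    by (simp add: complete_minus_edge_def delete_edges_def complete_graph_def)
  have edges: "(\<forall>i<5. \<forall>j<i. {j, i} \<in> [{..<5}]\<^bsup>2\<^esup> - {{0, 1}} \<longrightarrow> c {xs ! j, xs ! i} = k) \<longleftrightarrow>
      c {xs ! 0, xs ! 2} = k \<and> c {xs ! 0, xs ! 3} = k \<and> c {xs ! 0, xs ! 4} = k \<and>
      c {xs ! 1, xs ! 2} = k \<and> c {xs ! 1, xs ! 3} = k \<and> c {xs ! 1, xs ! 4} = k \<and>
      c {xs ! 2, xs ! 3} = k \<and> c {xs ! 2, xs ! 4} = k \<and> c {xs ! 3, xs ! 4} = k" for xs :: "nat list"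
    by (simp add: numeral_eq_Suc All_less_Suc nsets_def doubleton_eq_iff conj_ac)
  show ?thesis
    unfolding eq contains_monochromatic_copy_iff[OF Diff_subset] edges ex_list_5 by simp
qed

text \<open>\<open>p\<close> is the image of the star centre 0, which keeps only its edge to
  \<open>a\<close>: the graph is a \<open>K_4\<close> with a pendant edge at
  \<open>a\<close>.\<close>

lemma copy_complete_minus_star_iff:
  "contains_copy (colour_class (complete_graph n) c k) (complete_minus_star 5 3) \<longleftrightarrow>
    (\<exists>p x y z a. distinct [p, x, y, z, a] \<and> set [p, x, y, z, a] \<subseteq> {..<n} \<and>
      c {p, a} = k \<and> c {x, y} = k \<and> c {x, z} = k \<and> c {x, a} = k \<and> c {y, z} = k \<and> c {y, a} = k \<and>
      c {z, a} = k)"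
proof -
  have eq: "complete_minus_star 5 3 = ({..<5}, [{..<5}]\<^bsup>2\<^esup> - {{0, i} | i. i \<in> {1..3}})"
    by (simp add: complete_minus_star_def delete_edges_def complete_graph_def)
  have star: "{{0, i} | i. i \<in> {1..3}} = {{0, 1}, {0, 2}, {0, 3 :: nat}}"
  proof -
    have "{1..3} = {1, 2, 3 :: nat}"
      by auto
    then show ?thesis
      by auto
  qed
  have edges: "(\<forall>i<5. \<forall>j<i. {j, i} \<in> [{..<5}]\<^bsup>2\<^esup> - {{0, 1}, {0, 2}, {0, 3 :: nat}} \<longrightarrow> c {xs ! j, xs ! i} = k) \<longleftrightarrow>
      c {xs ! 0, xs ! 4} = k \<and> c {xs ! 1, xs ! 2} = k \<and> c {xs ! 1, xs ! 3} = k \<and> c {xs ! 1, xs ! 4} = k \<and>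
      c {xs ! 2, xs ! 3} = k \<and> c {xs ! 2, xs ! 4} = k \<and> c {xs ! 3, xs ! 4} = k" for xs :: "nat list"
    by (simp add: numeral_eq_Suc All_less_Suc nsets_def doubleton_eq_iff conj_ac)
  show ?thesis
    unfolding eq star contains_monochromatic_copy_iff[OF Diff_subset] edges ex_list_5 by simp
qed

section \<open>The lower bound\<close>

text \<open>An executable search over the cliques of size \<open>k\<close> in \<open>xs\<close>:
  each chosen vertex cuts both lists down to its neighbours, so at the end \<open>zs\<close> holds
  the common neighbours of the clique.\<close>

fun few_common :: "('a \<Rightarrow> 'a \<Rightarrow> bool) \<Rightarrow> nat \<Rightarrow> nat \<Rightarrow> 'a list \<Rightarrow> 'a list \<Rightarrow> bool" where
  "few_common R m 0 xs zs \<longleftrightarrow> length zs \<le> m"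
| "few_common R m (Suc k) [] zs \<longleftrightarrow> True"
| "few_common R m (Suc k) (x # xs) zs \<longleftrightarrow>
     few_common R m k (filter (R x) xs) (filter (R x) zs) \<and> few_common R m (Suc k) xs zs"

lemma few_commonD:
  assumes "few_common R m k xs zs" "symp R" "X \<subseteq> set xs" "card X = k" "finite X"
    "\<And>x y. x \<in> X \<Longrightarrow> y \<in> X \<Longrightarrow> x \<noteq> y \<Longrightarrow> R x y" "distinct zs"
  shows "card {z \<in> set zs. \<forall>x\<in>X. R x z} \<le> m"
  using assms(1,3-)
proof (induction R m k xs zs arbitrary: X rule: few_common.induct)
  case (1 R m xs zs)
  then show ?case by (simp add: distinct_card)
next
  case (3 R m k x xs zs)
  show ?case
  proof (cases "x \<in> X")
    case True
    have eq: "{z \<in> set zs. \<forall>x\<in>X. R x z} = {z \<in> set (filter (R x) zs). \<forall>y\<in>X - {x}. R y z}"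
      using True by auto
    show ?thesis
      unfolding eq using "3.prems" True by (intro "3.IH"(1)) auto
  next
    case False
    with "3.prems" show ?thesis by (intro "3.IH"(2)) auto
  qed
qed auto

text \<open>
  Three blocks of six vertices; the graph is invariant under the simultaneous rotation of the blocks
  and was found by a search among such graphs.
\<close>

definition nbrs :: "nat \<Rightarrow> nat list" where
  "nbrs v = [[1, 3, 5, 7, 8, 9, 12, 15],
    [0, 2, 4, 8, 9, 10, 13, 16],
    [1, 3, 5, 9, 10, 11, 14, 17],
    [0, 2, 4, 6, 10, 11, 12, 15],
    [1, 3, 5, 6, 7, 11, 13, 16],
    [0, 2, 4, 6, 7, 8, 14, 17],
    [3, 4, 5, 9, 12, 13, 14, 16],
    [0, 4, 5, 10, 13, 14, 15, 17],
    [0, 1, 5, 11, 12, 14, 15, 16],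
    [0, 1, 2, 6, 13, 15, 16, 17],
    [1, 2, 3, 7, 12, 14, 16, 17],
    [2, 3, 4, 8, 12, 13, 15, 17],
    [0, 3, 6, 8, 10, 11, 13, 17],
    [1, 4, 6, 7, 9, 11, 12, 14],
    [2, 5, 6, 7, 8, 10, 13, 15],
    [0, 3, 7, 8, 9, 11, 14, 16],
    [1, 4, 6, 8, 9, 10, 15, 17],
    [2, 5, 7, 9, 10, 11, 12, 16]] ! v"

definition adj :: "nat \<Rightarrow> nat \<Rightarrow> bool" where
  "adj x y \<longleftrightarrow> x \<noteq> y \<and> (y \<in> set (nbrs x) \<or> x \<in> set (nbrs y))"

definition nonadj :: "nat \<Rightarrow> nat \<Rightarrow> bool" where
  "nonadj x y \<longleftrightarrow> x \<noteq> y \<and> \<not> adj x y"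

abbreviation "V18 \<equiv> [0,1,2,3,4,5,6,7,8,9,10,11,12,13,14,15,16,17] :: nat list"

lemmas nbrs_eval = nbrs_def[of 0, simplified]
  nbrs_def[of "Suc 0", simplified]
  nbrs_def[of 2, simplified]
  nbrs_def[of 3, simplified]
  nbrs_def[of 4, simplified]
  nbrs_def[of 5, simplified]
  nbrs_def[of 6, simplified]
  nbrs_def[of 7, simplified]
  nbrs_def[of 8, simplified]
  nbrs_def[of 9, simplified]
  nbrs_def[of 10, simplified]
  nbrs_def[of 11, simplified]
  nbrs_def[of 12, simplified]
  nbrs_def[of 13, simplified]
  nbrs_def[of 14, simplified]
  nbrs_def[of 15, simplified]
  nbrs_def[of 16, simplified]
  nbrs_def[of 17, simplified]

text \<open>Yields a truth value for each ordered pair of vertices, so that the simplifier can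
  evaluate \<open>few_common\<close>.\<close>

lemma adj_table:
  "list_all (\<lambda>x. list_all (\<lambda>y. adj x y \<longleftrightarrow>
     x \<noteq> y \<and> (y \<in> set (nbrs x) \<or> x \<in> set (nbrs y))) V18) V18"
  "list_all (\<lambda>x. list_all (\<lambda>y. nonadj x y \<longleftrightarrow>
     x \<noteq> y \<and> \<not> (y \<in> set (nbrs x) \<or> x \<in> set (nbrs y))) V18) V18"
  by (simp_all only: adj_def nonadj_def list_all_iff) simp_all

lemmas adj_eval = adj_table[simplified nbrs_eval list.pred_inject list.set One_nat_def, simplified]

text \<open>A blue \<open>K_4\<close> would be a blue triangle with a common blue neighbour.\<close>

lemma few_common_adj: "few_common adj 0 (Suc (Suc (Suc 0))) V18 V18"
  by (simp add: adj_eval)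

text \<open>A red \<open>K_5 - e\<close> would be a red triangle with two common red
  neighbours.\<close>

lemma few_common_nonadj: "few_common nonadj 1 (Suc (Suc (Suc 0))) V18 V18"
  by (simp add: adj_eval)

lemma lower_bound:
  "\<exists>c. \<not> contains_copy (colour_class (complete_graph 18) c Red) (complete_minus_edge 5) \<and>
     \<not> contains_copy (colour_class (complete_graph 18) c Blue) (complete_minus_star 5 3)"
proof (intro exI conjI)
  let ?c = "\<lambda>e. if \<exists>x y. e = {x, y} \<and> adj x y then Blue else Red"
  have sym: "symp adj" "symp nonadj"
    by (auto simp: symp_def adj_def nonadj_def)
  have c: "?c {x, y} = Blue \<longleftrightarrow> adj x y" "?c {x, y} = Red \<longleftrightarrow> \<not> adj x y" for x y
    using sym(1) by (auto simp: doubleton_eq_iff dest: sympD)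
  have V: "set V18 = {..<18}" "distinct V18"
    by (auto simp: numeral_eq_Suc less_Suc_eq)
  have Red: "False" if "distinct [a, b, x, y, z]" "set [a, b, x, y, z] \<subseteq> {..<18}"
    "\<not> adj a x" "\<not> adj a y" "\<not> adj a z" "\<not> adj b x" "\<not> adj b y" "\<not> adj b z"
    "\<not> adj x y" "\<not> adj x z" "\<not> adj y z" for a b x y z
  proof -
    have flip: "\<not> adj x a" "\<not> adj y a" "\<not> adj z a" "\<not> adj x b" "\<not> adj y b" "\<not> adj z b"
      "\<not> adj y x" "\<not> adj z x" "\<not> adj z y"
      using that sympD[OF sym(1)] by blast+
    have "card {w \<in> set V18. \<forall>x\<in>{x, y, z}. nonadj x w} \<le> 1"
      using that flip by (intro few_commonD[OF few_common_nonadj sym(2) _ _ _ _ V(2)])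
        (auto simp only: V(1), auto simp: nonadj_def)
    moreover have "{a, b} \<subseteq> {w \<in> set V18. \<forall>x\<in>{x, y, z}. nonadj x w}"
      using that flip unfolding V(1) by (auto simp: nonadj_def)
    then have "card {a, b} \<le> card {w \<in> set V18. \<forall>x\<in>{x, y, z}. nonadj x w}"
      by (intro card_mono) auto
    ultimately show False
      using that(1) by simp
  qed
  show "\<not> contains_copy (colour_class (complete_graph 18) ?c Red) (complete_minus_edge 5)"
    unfolding copy_complete_minus_edge_iff c using Red by blast
  \<comment> \<open>The blue graph contains no \<open>K_4\<close> at all, with or without a pendant
    edge.\<close>
  have Blue: "False" if "distinct [x, y, z, a]" "set [x, y, z, a] \<subseteq> {..<18}"
    "adj x y" "adj x z" "adj x a" "adj y z" "adj y a" "adj z a" for x y z a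
  proof -
    have flip: "adj y x" "adj z x" "adj z y"
      using that sympD[OF sym(1)] by blast+
    have "card {w \<in> set V18. \<forall>x\<in>{x, y, z}. adj x w} \<le> 0"
      using that flip by (intro few_commonD[OF few_common_adj sym(1) _ _ _ _ V(2)])
        (auto simp only: V(1), auto)
    then have "{w \<in> set V18. \<forall>x\<in>{x, y, z}. adj x w} = {}"
      by (simp only: le_zero_eq card_eq_0_iff) simp
    then show False
      using that unfolding V(1) by auto
  qed
  show "\<not> contains_copy (colour_class (complete_graph 18) ?c Blue) (complete_minus_star 5 3)"
    unfolding copy_complete_minus_star_iff c using Blue by auto
qed

section \<open>The upper bound\<close>

lemma upper_bound:
  assumes "n \<ge> 19"
  shows "contains_copy (colour_class (complete_graph n) c Red) (complete_minus_edge 5) \<or>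
    contains_copy (colour_class (complete_graph n) c Blue) (complete_minus_star 5 3)"
proof (rule ccontr)
  assume neg: "\<not> ?thesis"
  define B where "B x y \<longleftrightarrow> c {x, y} = Blue" for x y :: nat
  have sym: "symp B" and flip: "B x y = B y x" for x y
    by (simp_all add: symp_def B_def insert_commute)
  have red: "c {x, y} = Red \<longleftrightarrow> \<not> B x y" for x y
    unfolding B_def by (cases "c {x, y}") auto
  have no_red: "B a x \<or> B a y \<or> B a z \<or> B b x \<or> B b y \<or> B b z \<or> B x y \<or> B x z \<or> B y z"
    if "distinct [a, b, x, y, z]" "set [a, b, x, y, z] \<subseteq> {..<n}" for a b x y z
    using neg that unfolding copy_complete_minus_edge_iff red by blast
  have no_blue: "\<not> B p a \<or> \<not> B x y \<or> \<not> B x z \<or> \<not> B x a \<or> \<not> B y z \<or> \<not> B y a \<or> \<not> B z a"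
    if "distinct [p, x, y, z, a]" "set [p, x, y, z, a] \<subseteq> {..<n}" for p x y z a
    using neg that unfolding copy_complete_minus_star_iff B_def[symmetric] by blast
  have "\<not> avoids B 4 5 {..<19}"
    using avoids_4_5_card[OF sym, of "{..<19}"] by auto
  then obtain xs where xs: "distinct xs" "set xs \<subseteq> {..<19}"
    and "length xs = 4 \<and> \<not> some_true (map Not (edge_list B xs)) \<or> length xs = 5 \<and> \<not> two_true (edge_list B xs)"
    unfolding avoids_def by blast
  then consider (blue) "length xs = 4" "\<not> some_true (map Not (edge_list B xs))"
    | (red) "length xs = 5" "\<not> two_true (edge_list B xs)"
    by blast
  then show False
  proof cases
    case red
    then obtain a b x y z where eq: "xs = [a, b, x, y, z]"
      by (auto simp: numeral_eq_Suc length_Suc_conv)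
    have d: "distinct [a, b, x, y, z]" "set [a, b, x, y, z] \<subseteq> {..<n}"
      using xs assms unfolding eq by auto
    \<comment> \<open>One instance for each of the ten pairs that may carry the only blue edge; that
      pair takes the place of the deleted edge.\<close>
    note perms = no_red[of a b x y z] no_red[of a x b y z] no_red[of a y b x z] no_red[of a z b x y]
      no_red[of b x a y z] no_red[of b y a x z] no_red[of b z a x y]
      no_red[of x y a b z] no_red[of x z a b y] no_red[of y z a b x]
    have "B a x \<or> B a y \<or> B a z \<or> B b x \<or> B b y \<or> B b z \<or> B x y \<or> B x z \<or> B y z"
      "B a b \<or> B a y \<or> B a z \<or> B x b \<or> B x y \<or> B x z \<or> B b y \<or> B b z \<or> B y z"
      "B a b \<or> B a x \<or> B a z \<or> B y b \<or> B y x \<or> B y z \<or> B b x \<or> B b z \<or> B x z"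
      "B a b \<or> B a x \<or> B a y \<or> B z b \<or> B z x \<or> B z y \<or> B b x \<or> B b y \<or> B x y"
      "B b a \<or> B b y \<or> B b z \<or> B x a \<or> B x y \<or> B x z \<or> B a y \<or> B a z \<or> B y z"
      "B b a \<or> B b x \<or> B b z \<or> B y a \<or> B y x \<or> B y z \<or> B a x \<or> B a z \<or> B x z"
      "B b a \<or> B b x \<or> B b y \<or> B z a \<or> B z x \<or> B z y \<or> B a x \<or> B a y \<or> B x y"
      "B x a \<or> B x b \<or> B x z \<or> B y a \<or> B y b \<or> B y z \<or> B a b \<or> B a z \<or> B b z"
      "B x a \<or> B x b \<or> B x y \<or> B z a \<or> B z b \<or> B z y \<or> B a b \<or> B a y \<or> B b y"
      "B y a \<or> B y b \<or> B y x \<or> B z a \<or> B z b \<or> B z x \<or> B a b \<or> B a x \<or> B b x"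
      by (rule perms; use d in auto)+
    moreover have "B x a = B a x" "B y a = B a y" "B z a = B a z" "B x b = B b x" "B y b = B b y"
      "B z b = B b z" "B y x = B x y" "B z x = B x z" "B z y = B y z" "B b a = B a b"
      by (rule flip)+
    ultimately show False
      using red(2) unfolding eq edge_list.simps list.map append.simps two_true.simps some_true.simps
      by sat
  next
    case blue
    then obtain a b d e where eq: "xs = [a, b, d, e]"
      by (auto simp: numeral_eq_Suc length_Suc_conv)
    have K4: "B a b" "B a d" "B a e" "B b d" "B b e" "B d e" "distinct [a, b, d, e]"
      "set [a, b, d, e] \<subseteq> {..<n}"
      using blue(2) xs assms unfolding eq by auto
    define W where "W = {..<n} - {a, b, d, e}"
    have "card W = n - 4"
      unfolding W_def using K4(7,8) by (subst card_Diff_subset) auto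
    then have W: "finite W" "card W \<ge> 15"
      using assms by (auto simp: W_def)
    \<comment> \<open>A blue edge from \<open>w\<close> to the \<open>K_4\<close> would be a pendant
      edge.\<close>
    have ab: "\<not> B a w \<and> \<not> B b w" if "w \<in> W" for w
      using no_blue[of w b d e a] no_blue[of w a d e b] K4 that flip
      by (auto simp: W_def)
    \<comment> \<open>A red triangle in \<open>W\<close> would form a red \<open>K_5 - e\<close>
      with \<open>a\<close> and \<open>b\<close>, where \<open>a b\<close> is the missing
      edge.\<close>
    have tri: "B x y \<or> B x z \<or> B y z" if "distinct [x, y, z]" "set [x, y, z] \<subseteq> W" for x y z
      using no_red[of a b x y z] K4(7,8) ab[of x] ab[of y] ab[of z] that by (auto simp: W_def)
    \<comment> \<open>By \<open>tri\<close>, red neighbours of \<open>v\<close> are pairwise joined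
      in blue; five of them would form a blue \<open>K_5\<close>, which contains a
      \<open>K_4\<close> with a pendant edge.\<close>
    have conbhd_small: "card (conbhd B U v) \<le> 4" if "v \<in> W" "U \<subseteq> W" for v U
    proof (rule ccontr)
      assume "\<not> ?thesis"
      then obtain X where X: "X \<subseteq> conbhd B U v" "card X = 5" "finite X"
        using obtain_subset_with_card_n[of 5 "conbhd B U v"] by auto
      obtain ys where ys: "set ys = X" "distinct ys"
        using finite_distinct_list[OF X(3)] by blast
      then have "length ys = 5"
        using X(2) distinct_card by fastforce
      then obtain p x y z w where ys_eq: "ys = [p, x, y, z, w]"
        by (auto simp: numeral_eq_Suc length_Suc_conv)
      have "B x y" if "x \<in> X" "y \<in> X" "x \<noteq> y" for x y
        using tri[of v x y] X(1) that \<open>v \<in> W\<close> \<open>U \<subseteq> W\<close> by (auto simp: conbhd_def)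
      then show False
        using no_blue[of p x y z w] ys X(1) that(2) unfolding ys_eq
        by (auto simp: conbhd_def W_def)
    qed
    obtain w where w: "w \<in> W"
      using W by fastforce
    define N where "N = nbhd B W w"
    have N: "N \<subseteq> W" "finite N"
      using W(1) by (auto simp: N_def nbhd_def)
    \<comment> \<open>At least 14 other vertices, at most four of them joined to \<open>w\<close> in
      red. Likewise, \<open>u\<close> has at least 9 - 4 blue neighbours in \<open>N\<close>, of
      which three are taken below.\<close>
    have "card N \<ge> 10"
      using card_nbhd_conbhd[OF W(1) w, of B] conbhd_small[OF w order_refl] W(2)
      unfolding N_def by linarith
    obtain u where u: "u \<in> N"
      using \<open>card N \<ge> 10\<close> by fastforce
    have "u \<in> W"
      using N(1) u by blast
    then have "card (nbhd B N u) \<ge> 3"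
      using card_nbhd_conbhd[OF N(2) u, of B] conbhd_small[of u N] N(1) \<open>card N \<ge> 10\<close> by linarith
    then obtain X where X: "X \<subseteq> nbhd B N u" "card X = 3"
      using obtain_subset_with_card_n by blast
    then obtain x y z where xyz: "X = {x, y, z}" "x \<noteq> y" "x \<noteq> z" "y \<noteq> z"
      unfolding card_3_iff by blast
    have N_props: "B w t" "t \<noteq> w" "t < n" if "t \<in> N" for t
      using that by (auto simp: N_def nbhd_def W_def)
    have X_props: "t \<in> N" "B u t" "t \<noteq> u" if "t \<in> X" for t
      using that X(1) by (auto simp: nbhd_def)
    have "w < n"
      using w by (simp add: W_def)
    \<comment> \<open>Otherwise \<open>x\<close>, \<open>y\<close>, \<open>u\<close>,
      \<open>w\<close> form a blue \<open>K_4\<close> with the pendant edge \<open>z w\<close>. So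
      \<open>X\<close> is a red triangle, contrary to \<open>tri\<close>.\<close>
    have no: "\<not> B x y" if "{x, y, z} \<subseteq> X" "distinct [x, y, z]" for x y z
    proof
      assume "B x y"
      have X: "x \<in> X" "y \<in> X" "z \<in> X"
        using that(1) by auto
      then have N: "x \<in> N" "y \<in> N" "z \<in> N"
        using X_props(1) by blast+
      have "B z w" "B x u" "B x w" "B y u" "B y w" "B u w"
        using X N u N_props(1) X_props(2) flip by metis+
      moreover have "distinct [z, x, y, u, w]"
        using that(2) X N u N_props(2) X_props(3) by auto
      moreover have "set [z, x, y, u, w] \<subseteq> {..<n}"
        using N u N_props(3) \<open>w < n\<close> by simp
      ultimately show False
        using no_blue[of z x y u w] \<open>B x y\<close> by blast
    qed
    have "\<not> B x y" "\<not> B x z" "\<not> B y z"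
      using no[of x y z] no[of x z y] no[of y z x] xyz by auto
    then show False
      using tri[of x y z] xyz X_props(1) N(1) by auto
  qed
qed

theorem corollary3:
  shows "ramsey_number (complete_minus_edge 5) (complete_minus_star 5 3) = 19"
  unfolding ramsey_number_def
proof (rule Least_equality)
  show "\<forall>n\<ge>19. \<forall>c. contains_copy (colour_class (complete_graph n) c Red) (complete_minus_edge 5) \<or>
      contains_copy (colour_class (complete_graph n) c Blue) (complete_minus_star 5 3)"
    using upper_bound by blast
  show "19 \<le> N" if "\<forall>n\<ge>N. \<forall>c.
      contains_copy (colour_class (complete_graph n) c Red) (complete_minus_edge 5) \<or>
      contains_copy (colour_class (complete_graph n) c Blue) (complete_minus_star 5 3)" for N
  proof (rule ccontr)
    assume "\<not> 19 \<le> N"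
    then have "N \<le> 18"
      by simp
    \<comment> \<open>The property assumed for all \<open>n \<ge> N\<close> would hold at
      \<open>n = 18\<close>.\<close>
    with that lower_bound show False
      by blast
  qed
qed

end
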